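(* Let $n$ be even and let $1\le m\le n-1$. Let $\mathbf{r}_1,\dots,\mathbf{r}_n$ be independent random vectors, each chosen uniformly from the set of $(0,1)$-vectors in $\mathbb{R}^n$ with exactly $n/2$ zero components (the rows of the random matrix $Q_n$). Then for every $C>0$, $$\mathbb{P}\big(\mathbf{r}_1,\dots,\mathbf{r}_m \text{ span a subspace } H \text{ of dimension } m \text{ and } \mathbf{r}_{m+1}\in H\big)=O(n^{-C}),$$ where the implied constant depends only on $C$. *)

theory Defs
  imports "HOL-Probability.Probability" "Jordan_Normal_Form.DL_Rank"
begin

definition balanced_vecs :: "nat \<Rightarrow> real vec set" where
  "balanced_vecs n =
     {v \<in> carrier_vec n. (\<forall>i<n. v $ i \<in> {0, 1}) \<and> card {i. i < n \<and> v $ i = 0} = n div 2}"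

lemma finite_balanced_vecs: "finite (balanced_vecs n)"
proof (rule finite_subset)
  show "balanced_vecs n \<subseteq> vec_of_list ` {xs. set xs \<subseteq> {0, 1} \<and> length xs = n}"
  proof
    fix v assume v: "v \<in> balanced_vecs n"
    have "set (list_of_vec v) \<subseteq> {0, 1}"
      using v by (auto simp: balanced_vecs_def set_list_of_vec vec_set_def)
    moreover have "length (list_of_vec v) = n"
      using v by (auto simp: balanced_vecs_def)
    moreover have "v = vec_of_list (list_of_vec v)"
      by (simp add: vec_list)
    ultimately show "v \<in> vec_of_list ` {xs. set xs \<subseteq> {0, 1} \<and> length xs = n}"
      by blast
  qed
qed (simp add: finite_lists_length_eq)

lemma balanced_vecs_nonempty: "balanced_vecs n \<noteq> {}"
proof -
  have "{i. i < n \<and> vec n (\<lambda>i. if i < n div 2 then 0 else (1::real)) $ i = 0} = {..<n div 2}"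
    by (auto split: if_splits)
  hence "vec n (\<lambda>i. if i < n div 2 then 0 else 1) \<in> balanced_vecs n"
    by (auto simp: balanced_vecs_def)
  thus ?thesis by blast
qed

text \<open>
  The joint law of the rows \<open>r 1, \<dots>, r n\<close> of \<open>Q\<^sub>n\<close>: under the product distribution they are independent
  and each is uniform on \<open>balanced_vecs n\<close> (which is finite and nonempty, as \<open>pmf_of_set\<close> requires).
  Outside \<open>{1..n}\<close> the value \<open>0\<^sub>v n\<close> is an irrelevant default of \<open>Pi_pmf\<close>.
\<close>
definition Q_rows :: "nat \<Rightarrow> (nat \<Rightarrow> real vec) pmf" where
  "Q_rows n = Pi_pmf {1..n} (0\<^sub>v n) (\<lambda>_. pmf_of_set (balanced_vecs n))"

lemma Q_rows_marginal:
  assumes "i \<in> {1..n}"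
  shows "map_pmf (\<lambda>r. r i) (Q_rows n) = pmf_of_set (balanced_vecs n)"
  using assms by (simp add: Q_rows_def Pi_pmf_component)

lemma Q_rows_indep:
  "prob_space.indep_vars (measure_pmf (Q_rows n)) (\<lambda>_. count_space UNIV) (\<lambda>i r. r i) {1..n}"
  unfolding Q_rows_def by (rule indep_vars_Pi_pmf) simp

text \<open>
  Linear span and dimension of a subspace in \<open>\<real>\<^sup>n\<close>, i.e. in the \<open>n\<close>-dimensional space
  with carrier \<open>carrier_vec n\<close>.
\<close>
abbreviation span_vec :: "nat \<Rightarrow> real vec set \<Rightarrow> real vec set" where
  "span_vec n S \<equiv> LinearCombinations.module.span class_ring (module_vec TYPE(real) n) S"

abbreviation dim_subspace :: "nat \<Rightarrow> real vec set \<Rightarrow> nat" where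
  "dim_subspace n H \<equiv> vectorspace.dim class_ring ((module_vec TYPE(real) n)\<lparr>carrier := H\<rparr>)"

end

theory Submission
  imports Defs "HOL-Number_Theory.Number_Theory" "HOL-Real_Asymp.Real_Asymp"
begin

text \<open>
  Reduce modulo a prime \<open>p\<close> slightly larger than a power of \<open>n\<close>. A real dependency among the rows
  becomes a dependency modulo \<open>p\<close>, so some row is orthogonal to a nonzero vector \<open>v\<close> modulo \<open>p\<close> that
  is normal to the other \<open>n - 1\<close> rows. By Fourier inversion, \<open>v\<close> is orthogonal to a random row with
  probability \<open>O(1 / p)\<close>, unless many frequencies \<open>x\<close> (the spectrum of \<open>v\<close>) almost align all phases
  \<open>x v\<^sub>i / p\<close>. In that case a logarithmic number of frequencies chosen greedily from the spectrum
  confines almost all coordinates of \<open>v\<close> to a translate of a Bohr set; Parseval's identity and the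
  Cauchy-Davenport theorem show that this Bohr set is so small that the union bound over all such
  \<open>v\<close> wins against the probability that \<open>v\<close> is orthogonal to \<open>n - 1\<close> random rows.
\<close>

subsection \<open>Additive characters modulo an integer\<close>

text \<open>Over the reals the possible normal vectors form a continuum; modulo \<open>p\<close>
  there are only \<open>p ^ n\<close>. A union bound over all of them still fails: a generic
  \<open>v\<close> is orthogonal to a random row with probability K / p for some constant K > 1, and
  \<open>p ^ n\<close> vectors against (K / p)^(n-1) leave K^(n-1) * p. Hence the split by the size
  of the spectrum. For a small spectrum no union is taken: the loss is only the O(1 / p) coming from
  the one row left out of the choice of \<open>v\<close>. For a large spectrum a union is
  affordable, since the candidates number about b^n for a Bohr set of size b, up to a factor
  exp(O(log^3 n)), while each has vanishing probability at most (4/5) / b; the gain (4/5)^(n-1)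
  beats every such factor. The row left out is not known in advance, which costs a further factor n;
  therefore \<open>p\<close> exceeds n^(C+1), not just n^C.\<close>

definition unit_char :: "nat \<Rightarrow> int \<Rightarrow> complex" where
  "unit_char p a = cis (2 * pi * real_of_int a / real p)"

lemma norm_unit_char [simp]: "norm (unit_char p a) = 1"
  by (simp add: unit_char_def)

lemma unit_char_0 [simp]: "unit_char p 0 = 1"
  by (simp add: unit_char_def)

lemma unit_char_add: "unit_char p (a + b) = unit_char p a * unit_char p b"
  by (simp add: unit_char_def cis_mult add_divide_distrib distrib_left)

lemma unit_char_minus: "unit_char p (- a) = cnj (unit_char p a)"
  by (simp add: unit_char_def cis_cnj)

lemma unit_char_power: "unit_char p (a * int k) = unit_char p a ^ k"
  by (induction k) (simp_all add: distrib_left unit_char_add)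

lemma unit_char_sum_index: "unit_char p (\<Sum>i\<in>A. f i) = (\<Prod>i\<in>A. unit_char p (f i))"
  by (induction A rule: infinite_finite_induct) (auto simp: unit_char_add)

lemma unit_char_eq_1_iff:
  assumes "p > 0"
  shows "unit_char p a = 1 \<longleftrightarrow> int p dvd a"
proof
  assume "unit_char p a = 1"
  hence "cos (2 * pi * real_of_int a / real p) = 1"
    by (simp add: unit_char_def complex_eq_iff)
  then obtain k :: int where "2 * pi * real_of_int a / real p = of_int k * 2 * pi"
    by (auto simp: cos_one_2pi_int)
  hence "real_of_int a = real_of_int (k * int p)"
    using assms by (simp add: field_simps)
  hence "a = k * int p" by linarith
  thus "int p dvd a" by simp
next
  assume "int p dvd a"
  then obtain k where "a = int p * k" by blast
  thus "unit_char p a = 1"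
    using assms cis_multiple_2pi[of "of_int k"] by (simp add: unit_char_def mult.assoc)
qed

lemma unit_char_cong:
  assumes "p > 0" "[a = b] (mod int p)"
  shows "unit_char p a = unit_char p b"
proof -
  have "unit_char p (a - b) = 1"
    using assms by (simp add: unit_char_eq_1_iff cong_iff_dvd_diff)
  thus ?thesis using unit_char_add[of p "a - b" b] by simp
qed

lemma sum_unit_char:
  assumes "p > 0"
  shows "(\<Sum>x<p. unit_char p (a * int x)) = (if int p dvd a then of_nat p else 0)"
proof (cases "int p dvd a")
  case True
  hence "unit_char p (a * int x) = 1" for x
    using assms by (simp add: unit_char_eq_1_iff)
  thus ?thesis using True by simp
next
  case False
  hence ne: "unit_char p a \<noteq> 1" using assms by (simp add: unit_char_eq_1_iff)
  have "unit_char p a ^ p = 1"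
    using assms by (simp flip: unit_char_power add: unit_char_eq_1_iff)
  thus ?thesis using False ne by (simp add: unit_char_power geometric_sum)
qed

subsection \<open>Characters summed over the middle layer of the cube\<close>

definition layer :: "nat \<Rightarrow> nat \<Rightarrow> nat set set" where
  "layer n k = {A. A \<subseteq> {..<n} \<and> card A = k}"

lemma finite_layer [simp]: "finite (layer n k)"
  unfolding layer_def by (rule finite_subset[of _ "Pow {..<n}"]) auto

lemma card_layer: "card (layer n k) = n choose k"
  unfolding layer_def by (simp add: n_subsets)

text \<open>Coefficient extraction: the layer sum is the coefficient of t^k in the product of the 1
  + t z_i. The degree is n, so roots of unity of order n + 1 separate the coefficients:
  \<open>card A\<close> and \<open>k\<close> both lie between 0 and n, and are congruent modulo n +
  1 only if equal.\<close>

lemma elementary_symmetric_eq: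
  fixes z :: "nat \<Rightarrow> complex"
  assumes "k \<le> n"
  shows "of_nat (n + 1) * (\<Sum>A\<in>layer n k. \<Prod>i\<in>A. z i) =
    (\<Sum>h<n + 1. unit_char (n + 1) (- int k * int h) * (\<Prod>i<n. 1 + unit_char (n + 1) (int h) * z i))"
proof -
  let ?e = "unit_char (n + 1)"
  have "(\<Sum>h<n + 1. ?e (- int k * int h) * (\<Prod>i<n. 1 + ?e (int h) * z i)) =
        (\<Sum>h<n + 1. \<Sum>A\<in>Pow {..<n}. ?e ((int (card A) - int k) * int h) * (\<Prod>i\<in>A. z i))"
  proof (rule sum.cong[OF refl])
    fix h
    have "(\<Prod>i<n. 1 + ?e (int h) * z i) = (\<Prod>i<n. ?e (int h) * z i + 1)"
      by (simp add: add.commute)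
    also have "\<dots> = (\<Sum>A\<in>Pow {..<n}. \<Prod>i\<in>A. ?e (int h) * z i)"
      by (subst prod_add) auto
    also have "\<dots> = (\<Sum>A\<in>Pow {..<n}. ?e (int h * int (card A)) * (\<Prod>i\<in>A. z i))"
      by (simp add: prod.distrib unit_char_power)
    finally show "?e (- int k * int h) * (\<Prod>i<n. 1 + ?e (int h) * z i) =
        (\<Sum>A\<in>Pow {..<n}. ?e ((int (card A) - int k) * int h) * (\<Prod>i\<in>A. z i))"
      by (simp add: sum_distrib_left algebra_simps flip: unit_char_add mult.assoc)
  qed
  also have "\<dots> = (\<Sum>A\<in>Pow {..<n}. (\<Sum>h<n + 1. ?e ((int (card A) - int k) * int h)) * (\<Prod>i\<in>A. z i))"
    by (subst sum.swap) (simp only: sum_distrib_right)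
  also have "\<dots> = (\<Sum>A\<in>Pow {..<n}. if card A = k then of_nat (n + 1) * (\<Prod>i\<in>A. z i) else 0)"
  proof (rule sum.cong[OF refl])
    fix A assume "A \<in> Pow {..<n}"
    hence "card A \<le> n" using card_mono[of "{..<n}" A] by auto
    hence "int (n + 1) dvd int (card A) - int k \<longleftrightarrow> card A = k"
      using assms zdvd_not_zless[of "int (card A) - int k" "int (n+1)"]
        zdvd_not_zless[of "int k - int (card A)" "int (n+1)"]
      by (cases "card A" k rule: linorder_cases) (auto simp: dvd_diff_commute)
    thus "(\<Sum>h<n + 1. ?e ((int (card A) - int k) * int h)) * (\<Prod>i\<in>A. z i) =
        (if card A = k then of_nat (n + 1) * (\<Prod>i\<in>A. z i) else 0)"
      by (subst sum_unit_char) auto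
  qed
  also have "\<dots> = (\<Sum>A\<in>layer n k. of_nat (n + 1) * (\<Prod>i\<in>A. z i))"
    by (simp add: sum.If_cases layer_def Collect_conj_eq Pow_def)
  finally show ?thesis by (simp add: sum_distrib_left)
qed

text \<open>The product over all coordinates factorises, the layer sum does not; fixing the size of
  \<open>A\<close> costs one common phase \<open>w\<close>. This is the origin of the free rotation
  in \<open>spectrum\<close>, and the reason why \<open>v\<close> ends up near a translate of a Bohr
  set and not near the Bohr set itself.\<close>

lemma norm_elementary_symmetric_le:
  fixes z :: "nat \<Rightarrow> complex"
  assumes "k \<le> n" and M: "\<And>w. norm w = 1 \<Longrightarrow> norm (\<Prod>i<n. 1 + w * z i) \<le> M"
  shows "norm (\<Sum>A\<in>layer n k. \<Prod>i\<in>A. z i) \<le> M"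
proof -
  have "real (n + 1) * norm (\<Sum>A\<in>layer n k. \<Prod>i\<in>A. z i) =
      norm (of_nat (n + 1) * (\<Sum>A\<in>layer n k. \<Prod>i\<in>A. z i))"
    by (simp only: norm_mult norm_of_nat)
  also have "\<dots> \<le> (\<Sum>h<n + 1. norm (unit_char (n + 1) (- int k * int h) *
      (\<Prod>i<n. 1 + unit_char (n + 1) (int h) * z i)))"
    unfolding elementary_symmetric_eq[OF assms(1)] by (rule norm_sum)
  also have "\<dots> \<le> (\<Sum>h<n + 1. M)"
    unfolding norm_mult norm_unit_char mult_1_left by (intro sum_mono M) simp
  also have "\<dots> = real (n + 1) * M" by simp
  finally show ?thesis by (simp del: of_nat_add)
qed

text \<open>By the parallelogram law the squares of |1 + u| and |1 - u| add up to 4, and sqrt(4 - s)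
  \<le> 2 - s/4.\<close>

lemma norm_one_plus_le:
  fixes u :: complex
  assumes "norm u = 1"
  shows "norm (1 + u) \<le> 2 * (1 - (norm (1 - u))\<^sup>2 / 8)"
proof -
  have sq: "(norm (1 + u))\<^sup>2 = 4 - (norm (1 - u))\<^sup>2"
    using assms unfolding cmod_power2 by (simp add: cmod_def power2_eq_square algebra_simps)
  have "norm (1 - u) \<le> 2" using norm_triangle_ineq4[of 1 u] assms by simp
  hence d: "(norm (1 - u))\<^sup>2 \<le> 4" using power_mono[of "norm (1 - u)" 2 2] by simp
  have "(norm (1 + u))\<^sup>2 \<le> (2 * (1 - (norm (1 - u))\<^sup>2 / 8))\<^sup>2"
    unfolding sq by (simp add: power2_eq_square algebra_simps)
  thus ?thesis by (rule power2_le_imp_le) (use d in simp)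
qed

lemma norm_prod_one_plus_le:
  fixes z :: "nat \<Rightarrow> complex"
  assumes "\<And>i. i < n \<Longrightarrow> norm (z i) = 1" and "d \<ge> 0" "d \<le> 1"
    and "q \<le> card {i. i < n \<and> norm (1 - z i) > d}"
  shows "norm (\<Prod>i<n. 1 + z i) \<le> 2 ^ n * (1 - d\<^sup>2 / 8) ^ q"
proof -
  define F where "F = {i. i < n \<and> norm (1 - z i) > d}"
  have d1: "d\<^sup>2 \<le> 1" using assms by (simp add: power_le_one)
  have "norm (\<Prod>i<n. 1 + z i) = (\<Prod>i<n. norm (1 + z i))" by (simp add: prod_norm)
  also have "\<dots> \<le> (\<Prod>i<n. 2 * (if i \<in> F then 1 - d\<^sup>2 / 8 else 1))"
  proof (intro prod_mono conjI norm_ge_zero)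
    fix i assume i: "i \<in> {..<n}"
    have le: "norm (1 + z i) \<le> 2 * (1 - (norm (1 - z i))\<^sup>2 / 8)"
      using assms i by (intro norm_one_plus_le) auto
    show "norm (1 + z i) \<le> 2 * (if i \<in> F then 1 - d\<^sup>2 / 8 else 1)"
    proof (cases "i \<in> F")
      case True
      hence "d\<^sup>2 \<le> (norm (1 - z i))\<^sup>2" using assms by (intro power_mono) (auto simp: F_def)
      thus ?thesis using le True by simp
    next
      case False
      have "0 \<le> (norm (1 - z i))\<^sup>2" by simp
      with le have "norm (1 + z i) \<le> 2" by argo
      thus ?thesis using False by simp
    qed
  qed
  also have "\<dots> = 2 ^ n * (\<Prod>i<n. if i \<in> F then 1 - d\<^sup>2 / 8 else 1)"
    by (simp add: prod.distrib)
  also have "(\<Prod>i<n. if i \<in> F then 1 - d\<^sup>2 / 8 else 1) = (1 - d\<^sup>2 / 8) ^ card F"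
  proof -
    have "{..<n} \<inter> {i. i \<in> F} = F" by (auto simp: F_def)
    thus ?thesis by (subst prod.If_cases) auto
  qed
  also have "2 ^ n * \<dots> \<le> 2 ^ n * (1 - d\<^sup>2 / 8) ^ q"
    using assms d1 by (intro mult_left_mono power_decreasing) (auto simp: F_def)
  finally show ?thesis .
qed

section \<open>Vanishing subset sums and the spectrum of a vector\<close>

definition zero_sets :: "nat \<Rightarrow> nat \<Rightarrow> (nat \<Rightarrow> nat) \<Rightarrow> nat set set" where
  "zero_sets n p v = {A \<in> layer n (n div 2). p dvd (\<Sum>i\<in>A. v i)}"

text \<open>
  The constant \<open>1 / 131072\<close> below is \<open>d\<^sup>2 / 8\<close> for the tolerance \<open>d = 1 / 128\<close>, as in
  \<open>norm_prod_one_plus_le\<close>.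
\<close>

definition spectrum :: "nat \<Rightarrow> nat \<Rightarrow> nat \<Rightarrow> (nat \<Rightarrow> nat) \<Rightarrow> nat set" where
  "spectrum n p q v = {x. x < p \<and> (\<exists>w. norm w = 1 \<and>
     card {i. i < n \<and> norm (1 - w * unit_char p (int (x * v i))) > 1 / 128} \<le> q)}"

lemma finite_spectrum [simp]: "finite (spectrum n p q v)"
  by (rule finite_subset[of _ "{..<p}"]) (auto simp: spectrum_def)

lemma spectrum_subset: "spectrum n p q v \<subseteq> {..<p}"
  by (auto simp: spectrum_def)

text \<open>Turns the bound \<open>2 ^ n\<close> for products over the whole cube into a multiple of
  the layer size; the lost factor n is absorbed by the choice of \<open>q\<close>.\<close>

lemma two_power_le_layer:
  assumes "n > 0" "even n"
  shows "2 ^ n \<le> real n * real (card (layer n (n div 2)))"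
proof -
  obtain k where k: "n = 2 * k" using assms by blast
  hence "4 ^ k / (2 * real k) \<le> real (2 * k choose k)"
    using central_binomial_lower_bound[of k] assms by simp
  moreover have "(2::real) ^ n = 4 ^ k" by (simp add: k power_mult)
  ultimately show ?thesis using k assms by (simp add: card_layer field_simps)
qed

text \<open>Fourier inversion: \<open>p\<close> times the count is the sum of the character sums
  \<open>P x\<close> over all \<open>x < p\<close>. A frequency in the spectrum is bounded trivially
  by the layer size; hypothesis \<open>q\<close> makes every other one smaller by a factor
  \<open>p\<close>, so together these contribute only the \<open>+ 1\<close>.\<close>

lemma card_zero_sets_le:
  assumes n: "n > 0" "even n" and p: "p > 0"
    and q: "real n * real p * (1 - 1 / 131072) ^ q \<le> 1"
  shows "real p * real (card (zero_sets n p v)) \<le>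
    (real (card (spectrum n p q v)) + 1) * real (card (layer n (n div 2)))"
proof -
  let ?L = "layer n (n div 2)" and ?S = "spectrum n p q v"
  define P where "P x = (\<Sum>A\<in>?L. \<Prod>i\<in>A. unit_char p (int (x * v i)))" for x
  have P_le: "norm (P x) \<le> real (card ?L)" for x
  proof -
    have "norm (P x) \<le> (\<Sum>A\<in>?L. norm (\<Prod>i\<in>A. unit_char p (int (x * v i))))"
      unfolding P_def by (rule norm_sum)
    also have "\<dots> = real (card ?L)" by (simp flip: prod_norm)
    finally show ?thesis .
  qed
  have P_small: "real p * norm (P x) \<le> real (card ?L)" if x: "x < p" "x \<notin> ?S" for x
  proof -
    have "norm (P x) \<le> 2 ^ n * (1 - (1 / 128)\<^sup>2 / 8) ^ q" unfolding P_def
    proof (rule norm_elementary_symmetric_le)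
      fix w :: complex assume w: "norm w = 1"
      hence "\<not> card {i. i < n \<and> norm (1 - w * unit_char p (int (x * v i))) > 1 / 128} \<le> q"
        using x unfolding spectrum_def by blast
      thus "norm (\<Prod>i<n. 1 + w * unit_char p (int (x * v i))) \<le> 2 ^ n * (1 - (1 / 128)\<^sup>2 / 8) ^ q"
        using w by (intro norm_prod_one_plus_le) (auto simp: norm_mult)
    qed simp
    hence "norm (P x) \<le> 2 ^ n * (1 - 1 / 131072) ^ q" by (simp add: power_divide)
    also have "\<dots> \<le> real n * real (card ?L) * (1 - 1 / 131072) ^ q"
      by (intro mult_right_mono two_power_le_layer n) auto
    finally have "real p * norm (P x) \<le> (real n * real p * (1 - 1 / 131072) ^ q) * real (card ?L)"
      using p by (simp add: field_simps)
    also have "\<dots> \<le> 1 * real (card ?L)" by (intro mult_right_mono q) auto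
    finally show ?thesis by simp
  qed
  have "of_nat p * (of_nat (card (zero_sets n p v)) :: complex) =
      (\<Sum>A\<in>?L. if int p dvd int (\<Sum>i\<in>A. v i) then of_nat p else 0)"
    unfolding zero_sets_def int_dvd_int_iff by (subst sum.If_cases) (auto simp: Int_def mult.commute)
  also have "\<dots> = (\<Sum>A\<in>?L. \<Sum>x<p. unit_char p (int (\<Sum>i\<in>A. v i) * int x))"
    using p by (subst sum_unit_char) auto
  also have "\<dots> = (\<Sum>A\<in>?L. \<Sum>x<p. \<Prod>i\<in>A. unit_char p (int (x * v i)))"
    unfolding unit_char_sum_index[symmetric] of_nat_sum[symmetric]
    by (simp add: sum_distrib_left mult.commute)
  also have "\<dots> = (\<Sum>x<p. P x)"
    unfolding P_def by (rule sum.swap)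
  finally have "real p * real (card (zero_sets n p v)) = norm (\<Sum>x<p. P x)"
    by (metis norm_mult norm_of_nat)
  also have "\<dots> \<le> (\<Sum>x<p. norm (P x))" by (rule norm_sum)
  also have "\<dots> \<le> (\<Sum>x<p. (if x \<in> ?S then real (card ?L) else 0) + real (card ?L) / real p)"
  proof (rule sum_mono)
    fix x assume "x \<in> {..<p}"
    thus "norm (P x) \<le> (if x \<in> ?S then real (card ?L) else 0) + real (card ?L) / real p"
    proof (cases "x \<in> ?S")
      case True
      thus ?thesis using P_le[of x] by (simp add: add_increasing2)
    next
      case False
      thus ?thesis using P_small[of x] \<open>x \<in> {..<p}\<close> p by (simp add: field_simps)
    qed
  qed
  also have "\<dots> = real (card ?S) * real (card ?L) + real (card ?L)"
  proof -
    have "{..<p} \<inter> ?S = ?S" using spectrum_subset by blast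
    thus ?thesis using p by (simp add: sum.distrib sum.If_cases)
  qed
  finally show ?thesis by (simp add: algebra_simps)
qed

text \<open>Frequency 0 always lies in the spectrum, so the \<open>+ 1\<close> is absorbed.\<close>

lemma card_zero_sets_le':
  assumes n: "n > 0" "even n" and p: "p > 0"
    and q: "real n * real p * (1 - 1 / 131072) ^ q \<le> 1"
  shows "real p * real (card (zero_sets n p v)) \<le>
    2 * real (card (spectrum n p q v)) * real (card (layer n (n div 2)))"
proof -
  have "{i. i < n \<and> norm (1 - 1 * unit_char p (int (0 * v i))) > 1 / 128} = {}" by simp
  hence "0 \<in> spectrum n p q v"
    unfolding spectrum_def using p by (auto intro!: exI[of _ 1])
  hence "card (spectrum n p q v) \<ge> 1"
    by (metis One_nat_def Suc_leI card_gt_0_iff empty_iff finite_spectrum)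
  hence "(real (card (spectrum n p q v)) + 1) * real (card (layer n (n div 2))) \<le>
      (2 * real (card (spectrum n p q v))) * real (card (layer n (n div 2)))"
    by (intro mult_right_mono) auto
  thus ?thesis using card_zero_sets_le[OF assms] by (rule order_trans[rotated])
qed

subsection \<open>Large Fourier coefficients\<close>

lemma parseval_unit_char:
  assumes p: "p > 0" and S: "S \<subseteq> {..<p}"
  shows "(\<Sum>w<p. (norm (\<Sum>x\<in>S. unit_char p (int (x * w))))\<^sup>2) = real p * real (card S)"
proof -
  have fin: "finite S" using S finite_subset by blast
  have "complex_of_real (\<Sum>w<p. (norm (\<Sum>x\<in>S. unit_char p (int (x * w))))\<^sup>2) =
     (\<Sum>w<p. (\<Sum>x\<in>S. unit_char p (int (x * w))) * cnj (\<Sum>x\<in>S. unit_char p (int (x * w))))"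
    by (simp only: of_real_sum complex_norm_square)
  also have "\<dots> = (\<Sum>w<p. \<Sum>x\<in>S. \<Sum>y\<in>S. unit_char p ((int x - int y) * int w))"
  proof (rule sum.cong[OF refl])
    fix w
    have "unit_char p (int (x * w)) * cnj (unit_char p (int (y * w))) =
        unit_char p ((int x - int y) * int w)" for x y
      by (simp add: left_diff_distrib flip: unit_char_add unit_char_minus)
    thus "(\<Sum>x\<in>S. unit_char p (int (x * w))) * cnj (\<Sum>x\<in>S. unit_char p (int (x * w))) =
        (\<Sum>x\<in>S. \<Sum>y\<in>S. unit_char p ((int x - int y) * int w))"
      by (simp only: cnj_sum sum_product)
  qed
  also have "\<dots> = (\<Sum>x\<in>S. \<Sum>y\<in>S. \<Sum>w<p. unit_char p ((int x - int y) * int w))"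
    by (subst sum.swap, rule sum.cong[OF refl], rule sum.swap)
  also have "\<dots> = (\<Sum>x\<in>S. \<Sum>y\<in>S. if x = y then of_nat p else 0)"
  proof (intro sum.cong refl)
    fix x y assume "x \<in> S" "y \<in> S"
    hence "x < p" "y < p" using S by auto
    hence "int p dvd int x - int y \<longleftrightarrow> x = y"
      using zdvd_not_zless[of "int x - int y" "int p"] zdvd_not_zless[of "int y - int x" "int p"]
      by (cases x y rule: linorder_cases) (auto simp: dvd_diff_commute)
    thus "(\<Sum>w<p. unit_char p ((int x - int y) * int w)) = (if x = y then of_nat p else 0)"
      using p by (subst sum_unit_char) auto
  qed
  also have "\<dots> = complex_of_real (real p * real (card S))"
    using fin by simp
  finally show ?thesis by (simp only: of_real_eq_iff)
qed

text \<open>A phase within 1/2 of 1 has real part at least 7/8. If fewer than an eighth of the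
  phases are worse, the character sum over \<open>S\<close> has modulus at least
  \<open>card S / 2\<close>, and Parseval's identity limits how many \<open>w\<close> can have so
  large a sum.\<close>

lemma card_large_fourier_le:
  assumes p: "p > 0" and S: "S \<subseteq> {..<p}"
  shows "card {w. w < p \<and> 8 * card {x \<in> S. norm (unit_char p (int (x * w)) - 1) > 1 / 2} < card S}
           * card S \<le> 4 * p"
    (is "card ?W * _ \<le> _")
proof (cases "card S = 0")
  case False
  have fin: "finite S" using S finite_subset by blast
  let ?F = "\<lambda>w. \<Sum>x\<in>S. unit_char p (int (x * w))"
  have large: "real (card S) / 2 \<le> norm (?F w)" if w: "w \<in> ?W" for w
  proof -
    define B where "B = {x \<in> S. norm (unit_char p (int (x * w)) - 1) > 1 / 2}"
    have B: "B \<subseteq> S" "8 * card B < card S" using w by (auto simp: B_def)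
    have *: "(if x \<in> B then - 1 else 7 / 8) \<le> Re (unit_char p (int (x * w)))" if "x \<in> S" for x
    proof -
      let ?z = "unit_char p (int (x * w))"
      have "(norm (?z - 1))\<^sup>2 = 2 - 2 * Re ?z"
      proof -
        have "(Re ?z)\<^sup>2 + (Im ?z)\<^sup>2 = 1" by (metis cmod_power2 norm_unit_char one_power2)
        thus ?thesis unfolding cmod_power2 by (simp add: power2_eq_square algebra_simps)
      qed
      moreover have "- 1 \<le> Re ?z" using abs_Re_le_cmod[of ?z] by simp
      moreover have "(norm (?z - 1))\<^sup>2 \<le> (1 / 2)\<^sup>2" if "x \<notin> B"
        using that \<open>x \<in> S\<close> by (intro power_mono) (auto simp: B_def)
      ultimately show ?thesis by (auto simp: power2_eq_square)
    qed
    have "real (card S) / 2 \<le> 7 / 8 * (real (card S) - real (card B)) - real (card B)"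
    proof -
      have "8 * real (card B) < real (card S)" "0 \<le> real (card B)" using B(2) by linarith+
      thus ?thesis by argo
    qed
    also have "\<dots> = (\<Sum>x\<in>S. if x \<in> B then - 1 else 7 / 8)"
    proof -
      have "S \<inter> B = B" "S \<inter> - B = S - B" using B by auto
      thus ?thesis using B fin
        by (simp add: sum.If_cases card_Diff_subset finite_subset of_nat_diff card_mono)
    qed
    also have "\<dots> \<le> (\<Sum>x\<in>S. Re (unit_char p (int (x * w))))" by (intro sum_mono *)
    also have "\<dots> = Re (?F w)" by simp
    also have "\<dots> \<le> norm (?F w)" by (rule complex_Re_le_cmod)
    finally show ?thesis .
  qed
  have "real (card ?W) * (real (card S) / 2)\<^sup>2 = (\<Sum>w\<in>?W. (real (card S) / 2)\<^sup>2)" by simp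
  also have "\<dots> \<le> (\<Sum>w\<in>?W. (norm (?F w))\<^sup>2)"
    by (intro sum_mono power_mono large) auto
  also have "\<dots> \<le> (\<Sum>w<p. (norm (?F w))\<^sup>2)"
    by (intro sum_mono2) auto
  also have "\<dots> = real p * real (card S)" by (rule parseval_unit_char[OF assms])
  finally have "(real (card ?W) * real (card S)) * real (card S) \<le> (4 * real p) * real (card S)"
    by (simp add: power2_eq_square)
  hence "real (card ?W) * real (card S) \<le> 4 * real p"
    using False by (simp only: mult_le_cancel_right)
  hence "real (card ?W * card S) \<le> real (4 * p)" by simp
  thus ?thesis by linarith
qed simp

text \<open>Some element of \<open>S\<close> always hits an eighth of the remaining \<open>w \<in> Y\<close>.\<close>

lemma greedy_hitting_set:
  assumes "finite S" "S \<noteq> {}" "finite Y"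
    and dense: "\<And>w. w \<in> Y \<Longrightarrow> card S \<le> 8 * card {x \<in> S. R x w}"
    and "(7 / 8 :: real) ^ l * real (card Y) < 1"
  shows "\<exists>X\<subseteq>S. card X \<le> l \<and> (\<forall>w\<in>Y. \<exists>x\<in>X. R x w)"
  using assms(3-)
proof (induction l arbitrary: Y)
  case 0
  hence "Y = {}" by simp
  thus ?case by (intro exI[of _ "{}"]) auto
next
  case (Suc l)
  \<comment> \<open>Double counting of the pairs related by \<open>R\<close>: if every
    \<open>x\<close> hit less than an eighth of \<open>Y\<close>, some \<open>w\<close> would
    violate \<open>dense\<close>.\<close>
  have "\<exists>x\<in>S. card Y \<le> 8 * card {w \<in> Y. R x w}"
  proof (rule ccontr)
    assume "\<not> ?thesis"
    hence lt: "8 * card {w \<in> Y. R x w} < card Y" if "x \<in> S" for x using that by auto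
    have "card Y * card S = (\<Sum>w\<in>Y. card S)" by simp
    also have "\<dots> \<le> (\<Sum>w\<in>Y. 8 * card {x \<in> S. R x w})" by (intro sum_mono Suc.prems)
    also have "\<dots> = 8 * (\<Sum>w\<in>Y. \<Sum>x\<in>S. if R x w then 1 else 0)"
      using assms(1) by (simp add: sum_distrib_left sum.If_cases Int_def)
    also have "\<dots> = 8 * (\<Sum>x\<in>S. \<Sum>w\<in>Y. if R x w then 1 else 0)"
      by (subst sum.swap) simp
    also have "\<dots> = (\<Sum>x\<in>S. 8 * card {w \<in> Y. R x w})"
      using Suc.prems(1) by (simp add: sum_distrib_left sum.If_cases Int_def)
    also have "\<dots> < (\<Sum>x\<in>S. card Y)"
      using assms lt by (intro sum_strict_mono) auto
    finally show False by simp
  qed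
  then obtain x where x: "x \<in> S" "card Y \<le> 8 * card {w \<in> Y. R x w}" by blast
  define Z where "Z = {w \<in> Y. \<not> R x w}"
  have "Y = Z \<union> {w \<in> Y. R x w}" "Z \<inter> {w \<in> Y. R x w} = {}" by (auto simp: Z_def)
  hence "card Y = card Z + card {w \<in> Y. R x w}"
    using Suc.prems(1) by (metis card_Un_disjoint finite_Un)
  hence "real (card Z) \<le> 7 / 8 * real (card Y)" using x(2) by linarith
  hence "(7 / 8) ^ l * real (card Z) \<le> (7 / 8) ^ l * (7 / 8 * real (card Y))"
    by (intro mult_left_mono) auto
  also have "\<dots> < 1" using Suc.prems(3) by (simp add: mult_ac)
  finally have "\<exists>X\<subseteq>S. card X \<le> l \<and> (\<forall>w\<in>Z. \<exists>x\<in>X. R x w)"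
    using Suc.prems by (intro Suc.IH) (auto simp: Z_def)
  then obtain X where X: "X \<subseteq> S" "card X \<le> l" "\<forall>w\<in>Z. \<exists>x\<in>X. R x w" by blast
  show ?case
    by (rule exI[of _ "insert x X"]) (use X x in \<open>auto simp: Z_def intro: le_trans[OF card_insert_le_m1]
      finite_subset[OF _ assms(1)] card_insert_if\<close>)
qed

subsection \<open>The Cauchy-Davenport theorem\<close>

text \<open>A nonzero residue generates the additive group modulo a prime. The number of steps from
  \<open>a\<close> to \<open>x\<close> is x - a times the inverse \<open>y\<close> of
  \<open>d\<close>, with \<open>p\<close> added to stay within the naturals.\<close>

lemma add_closed_eq_all_residues:
  fixes A :: "nat set"
  assumes p: "prime p" and A: "A \<subseteq> {..<p}" "A \<noteq> {}" and d: "\<not> [d = 0] (mod p)"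
    and closed: "\<And>a. a \<in> A \<Longrightarrow> (a + d) mod p \<in> A"
  shows "A = {..<p}"
proof -
  obtain a where a: "a \<in> A" using A by blast
  have step: "(a + k * d) mod p \<in> A" for k
  proof (induction k)
    case 0 thus ?case using a A by auto
  next
    case (Suc k)
    have "(a + Suc k * d) mod p = ((a + k * d) mod p + d) mod p"
      by (simp add: mod_simps algebra_simps)
    thus ?case using closed[OF Suc] by simp
  qed
  have "x \<in> A" if "x < p" for x
  proof -
    have "coprime d p" using p d
      by (metis cong_0_iff coprime_commute prime_imp_coprime)
    then obtain y where y: "[d * y = 1] (mod p)"
      using cong_solve_coprime_nat by auto
    have "[(x + p - a) * (d * y) = (x + p - a) * 1] (mod p)"
      by (rule cong_scalar_left[OF y])
    hence "[a + (x + p - a) * y * d = a + (x + p - a) * 1] (mod p)"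
      by (intro cong_add cong_refl) (simp add: mult_ac)
    moreover have "a + (x + p - a) * 1 = x + p" using a A by auto
    ultimately have "(a + ((x + p - a) * y) * d) mod p = x"
      using that by (simp add: cong_def)
    thus ?thesis using step[of "(x + p - a) * y"] by simp
  qed
  thus ?thesis using A by auto
qed

definition sumset_mod :: "nat \<Rightarrow> nat set \<Rightarrow> nat set \<Rightarrow> nat set" where
  "sumset_mod p A B = (\<lambda>(a, b). (a + b) mod p) ` (A \<times> B)"

text \<open>Induction by the Dyson e-transform. If a translate of \<open>B\<close> meets
  \<open>A\<close> without lying inside it, the translate is joined to \<open>A\<close> and
  \<open>B\<close> is cut down to the part that lands in \<open>A\<close>: the sum of the sizes is
  kept and the sumset does not grow. If there is no such translate, \<open>B\<close> is a single
  point, or \<open>A\<close> is closed under a nonzero difference of elements of \<open>B\<close>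
  and hence contains all residues.\<close>

theorem cauchy_davenport:
  assumes p: "prime p" and "A \<subseteq> {..<p}" "B \<subseteq> {..<p}" "A \<noteq> {}" "B \<noteq> {}"
  shows "card (sumset_mod p A B) \<ge> min p (card A + card B - 1)"
  using assms(2-)
proof (induction "card B" arbitrary: A B rule: less_induct)
  case less
  have p0: "p > 0" using p prime_gt_0_nat by blast
  have fin: "finite A" "finite B" using less.prems finite_subset by blast+
  have fin': "finite (sumset_mod p A B)" using fin by (simp add: sumset_mod_def)
  show ?case
  proof (cases "\<exists>e b. b \<in> B \<and> (b + e) mod p \<in> A \<and> (\<exists>b'\<in>B. (b' + e) mod p \<notin> A)")
    case True
    then obtain e b b' where e: "b \<in> B" "(b + e) mod p \<in> A" "b' \<in> B" "(b' + e) mod p \<notin> A" by blast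
    define t where "t = (\<lambda>x. (x + e) mod p)"
    define C where "C = {x \<in> B. t x \<in> A}"
    define D where "D = A \<union> t ` B"
    have inj: "inj_on t B"
    proof (rule inj_onI)
      fix x y assume "x \<in> B" "y \<in> B" "t x = t y"
      hence "[x + e = y + e] (mod p)" "x < p" "y < p" using less.prems by (auto simp: t_def cong_def)
      thus "x = y" by (simp add: cong_add_rcancel_nat cong_less_modulus_unique_nat)
    qed
    have "C \<subset> B" using e by (auto simp: C_def t_def)
    hence cl: "card C < card B" using fin psubset_card_mono by blast
    have C: "C \<noteq> {}" using e by (auto simp: C_def t_def)
    have "A \<inter> t ` B = t ` C" by (auto simp: C_def)
    moreover have "card (t ` C) = card C"
      using inj by (intro card_image inj_on_subset[OF inj]) (auto simp: C_def)
    moreover have "card (t ` B) = card B" using inj by (rule card_image)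
    ultimately have cards: "card D + card C = card A + card B"
      using card_Un_Int[of A "t ` B"] fin unfolding D_def by simp
    have sub: "sumset_mod p D C \<subseteq> sumset_mod p A B"
    proof
      fix x assume "x \<in> sumset_mod p D C"
      then obtain a c where ac: "a \<in> D" "c \<in> C" "x = (a + c) mod p" by (auto simp: sumset_mod_def)
      show "x \<in> sumset_mod p A B"
      proof (cases "a \<in> A")
        case True
        thus ?thesis using ac by (auto simp: sumset_mod_def C_def)
      next
        case False
        then obtain y where y: "y \<in> B" "a = t y" using ac by (auto simp: D_def)
        \<comment> \<open>The shift \<open>e\<close> moves from \<open>y\<close> to
          \<open>c\<close>, and \<open>t c\<close> lies in \<open>A\<close> by the definition of
          \<open>C\<close>.\<close>
        have "x = (t c + y) mod p" using ac y by (simp add: t_def mod_simps add_ac)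
        thus ?thesis using ac y by (auto simp: sumset_mod_def C_def)
      qed
    qed
    have "min p (card D + card C - 1) \<le> card (sumset_mod p D C)"
    proof (rule less.hyps[OF cl])
      show "D \<subseteq> {..<p}" using less.prems p0 by (auto simp: D_def t_def)
      show "C \<subseteq> {..<p}" using less.prems by (auto simp: C_def)
      show "D \<noteq> {}" using less.prems by (auto simp: D_def)
    qed (rule C)
    also have "\<dots> \<le> card (sumset_mod p A B)" by (intro card_mono fin' sub)
    finally show ?thesis using cards by simp
  next
    case False
    obtain b where b: "b \<in> B" using less.prems by blast
    show ?thesis
    proof (cases "B = {b}")
      case True
      have "sumset_mod p A B = (\<lambda>a. (a + b) mod p) ` A" using True by (auto simp: sumset_mod_def)
      moreover have "inj_on (\<lambda>a. (a + b) mod p) A"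
      proof (rule inj_onI)
        fix x y assume "x \<in> A" "y \<in> A" "(x + b) mod p = (y + b) mod p"
        hence "[x + b = y + b] (mod p)" "x < p" "y < p" using less.prems by (auto simp: cong_def)
        thus "x = y" by (simp add: cong_add_rcancel_nat cong_less_modulus_unique_nat)
      qed
      ultimately show ?thesis using True by (simp add: card_image)
    next
      case False2: False
      then obtain b' where b': "b' \<in> B" "b' \<noteq> b" using b by blast
      have lt: "b < p" "b' < p" using b b' less.prems by auto
      have "A = {..<p}"
      proof (rule add_closed_eq_all_residues[OF p less.prems(1,3)])
        show "\<not> [b' + (p - b) = 0] (mod p)"
        proof
          assume "[b' + (p - b) = 0] (mod p)"
          hence "[b' + (p - b) + b = 0 + b] (mod p)" by (simp only: cong_add_rcancel_nat)
          hence "[b' + p = b] (mod p)" using lt by simp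
          hence "b' mod p = b mod p" by (simp add: cong_def)
          thus False using lt b' by simp
        qed
        fix a assume a: "a \<in> A"
        hence "a < p" using less.prems by auto
        hence "(b + (a + (p - b))) mod p = a" using lt by simp
        hence "(b' + (a + (p - b))) mod p \<in> A" using False a b b' by metis
        thus "(a + (b' + (p - b))) mod p \<in> A" by (simp add: add_ac)
      qed
      have "(\<lambda>a. (a + b) mod p) ` A \<subseteq> sumset_mod p A B" using b by (auto simp: sumset_mod_def)
      moreover have "inj_on (\<lambda>a. (a + b) mod p) A"
      proof (rule inj_onI)
        fix x y assume "x \<in> A" "y \<in> A" "(x + b) mod p = (y + b) mod p"
        hence "[x + b = y + b] (mod p)" "x < p" "y < p" using less.prems by (auto simp: cong_def)
        thus "x = y" by (simp add: cong_add_rcancel_nat cong_less_modulus_unique_nat)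
      qed
      ultimately have "card A \<le> card (sumset_mod p A B)" by (metis card_image card_mono fin')
      thus ?thesis using \<open>A = {..<p}\<close> by simp
    qed
  qed
qed

subsection \<open>Bohr sets\<close>

definition bohr :: "nat \<Rightarrow> nat set \<Rightarrow> real \<Rightarrow> nat set" where
  "bohr p X d = {w. w < p \<and> (\<forall>x\<in>X. norm (unit_char p (int (x * w)) - 1) \<le> d)}"

lemma finite_bohr [simp]: "finite (bohr p X d)"
  by (rule finite_subset[of _ "{..<p}"]) (auto simp: bohr_def)

lemma bohr_subset: "bohr p X d \<subseteq> {..<p}"
  by (auto simp: bohr_def)

lemma zero_in_bohr: "p > 0 \<Longrightarrow> d \<ge> 0 \<Longrightarrow> 0 \<in> bohr p X d"
  by (simp add: bohr_def)

lemma card_bohr_pos: "p > 0 \<Longrightarrow> d \<ge> 0 \<Longrightarrow> card (bohr p X d) > 0"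
  using zero_in_bohr[of p d X] by (metis card_gt_0_iff empty_iff finite_bohr)

lemma sumset_bohr_subset:
  assumes "p > 0"
  shows "sumset_mod p (bohr p X d) (bohr p X d) \<subseteq> bohr p X (2 * d)"
proof
  fix w assume "w \<in> sumset_mod p (bohr p X d) (bohr p X d)"
  then obtain a b where ab: "a \<in> bohr p X d" "b \<in> bohr p X d" "w = (a + b) mod p"
    by (auto simp: sumset_mod_def)
  have "norm (unit_char p (int (x * w)) - 1) \<le> 2 * d" if "x \<in> X" for x
  proof -
    let ?u = "unit_char p (int (x * a))" and ?v = "unit_char p (int (x * b))"
    have "[x * w = x * a + x * b] (mod p)"
      unfolding ab(3) by (simp add: cong_def mod_simps distrib_left)
    hence "[int (x * w) = int (x * a) + int (x * b)] (mod int p)"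
      by (metis cong_int_iff of_nat_add)
    hence "unit_char p (int (x * w)) = ?u * ?v"
      using assms by (metis unit_char_add unit_char_cong)
    also have "norm (?u * ?v - 1) \<le> norm (?u * (?v - 1)) + norm (?u - 1)"
      using norm_triangle_ineq[of "?u * (?v - 1)" "?u - 1"] by (simp add: algebra_simps)
    also have "\<dots> \<le> 2 * d" using ab that by (simp add: norm_mult bohr_def) force
    finally show ?thesis .
  qed
  thus "w \<in> bohr p X (2 * d)" using assms ab by (simp add: bohr_def)
qed

text \<open>The sumset of a Bohr set with itself lies in the Bohr set of twice the radius, so
  Cauchy-Davenport applies, with \<open>lt\<close> excluding the bound \<open>p\<close>. Subtracting
  1 on both sides makes the estimate an exact doubling that can be iterated.\<close>

lemma bohr_doubling:
  assumes p: "prime p" and "d \<ge> 0" and lt: "card (bohr p X (2 * d)) < p"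
  shows "2 * (card (bohr p X d) - 1) \<le> card (bohr p X (2 * d)) - 1"
proof -
  have p0: "p > 0" using p prime_gt_0_nat by blast
  have "bohr p X d \<noteq> {}" using zero_in_bohr[OF p0 assms(2)] by blast
  hence "min p (card (bohr p X d) + card (bohr p X d) - 1) \<le>
      card (sumset_mod p (bohr p X d) (bohr p X d))"
    by (intro cauchy_davenport p bohr_subset)
  also have "\<dots> \<le> card (bohr p X (2 * d))"
    by (intro card_mono finite_bohr sumset_bohr_subset p0)
  finally show ?thesis using lt by simp
qed

text \<open>Hitting all residues outside \<open>W\<close> by some \<open>x\<close> in
  \<open>X\<close> forces the Bohr set of radius 1/2 into \<open>W\<close>, which has at most
  \<open>4 * p / card S\<close> elements; five elements in \<open>S\<close> make this less than
  \<open>p\<close>, as doubling demands. The five halvings from 1/2 to 1/64 yield the factor 32.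
  Four would only bound Bohr size times vanishing probability by 1, which is no gain in the union
  bound.\<close>

lemma exists_small_bohr:
  assumes p: "prime p" and S: "S \<subseteq> {..<p}" "card S \<ge> 5"
    and l: "(7 / 8) ^ l * real p < 1"
  shows "\<exists>X\<subseteq>S. card X \<le> l \<and> 32 * (card (bohr p X (1 / 64)) - 1) * card S \<le> 4 * p"
proof -
  have p0: "p > 0" using p prime_gt_0_nat by blast
  let ?R = "\<lambda>x w. norm (unit_char p (int (x * w)) - 1) > 1 / 2"
  define W where "W = {w. w < p \<and> 8 * card {x \<in> S. ?R x w} < card S}"
  have W: "card W * card S \<le> 4 * p"
    unfolding W_def by (rule card_large_fourier_le[OF p0 S(1)])
  have W_lt: "card W < p"
  proof (rule ccontr)
    assume "\<not> card W < p"
    hence "p * 5 \<le> card W * card S" using S by (intro mult_le_mono) auto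
    thus False using W p0 by linarith
  qed
  have "\<exists>X\<subseteq>S. card X \<le> l \<and> (\<forall>w\<in>{..<p} - W. \<exists>x\<in>X. ?R x w)"
  proof (rule greedy_hitting_set)
    show "finite S" using S finite_subset by blast
    show "S \<noteq> {}" using S by auto
    have "(7 / 8) ^ l * real (card ({..<p} - W)) \<le> (7 / 8) ^ l * real p"
      using card_mono[of "{..<p}" "{..<p} - W"] by (intro mult_left_mono) auto
    thus "(7 / 8) ^ l * real (card ({..<p} - W)) < 1" using l by linarith
  qed (auto simp: W_def not_less)
  then obtain X where X: "X \<subseteq> S" "card X \<le> l" "\<forall>w\<in>{..<p} - W. \<exists>x\<in>X. ?R x w" by blast
  have sub: "bohr p X (1 / 2) \<subseteq> W"
    using X(3) by (force simp: bohr_def not_less)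
  have cW: "card (bohr p X d) \<le> card W" if "d \<le> 1 / 2" for d
  proof -
    have "bohr p X d \<subseteq> bohr p X (1 / 2)" using that by (fastforce simp: bohr_def)
    thus ?thesis using sub by (intro card_mono) (auto simp: W_def)
  qed
  have "2 * (card (bohr p X d) - 1) \<le> card (bohr p X (2 * d)) - 1" if "0 \<le> d" "d \<le> 1 / 4" for d
    using bohr_doubling[OF p that(1)] cW[of "2 * d"] W_lt that by simp
  from this[of "1 / 64"] this[of "1 / 32"] this[of "1 / 16"] this[of "1 / 8"] this[of "1 / 4"]
  have "32 * (card (bohr p X (1 / 64)) - 1) \<le> card (bohr p X (1 / 2)) - 1" by simp
  also have "\<dots> \<le> card W" using cW[of "1 / 2"] by simp
  finally have "32 * (card (bohr p X (1 / 64)) - 1) * card S \<le> card W * card S"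
    by (rule mult_le_mono1)
  thus ?thesis using X W by (intro exI[of _ X]) linarith
qed

subsection \<open>Vectors with a large spectrum\<close>

text \<open>Every \<open>x\<close> in \<open>X\<close> has at most \<open>q\<close> bad coordinates,
  and \<open>E\<close> collects them all. The rotation attached to \<open>x\<close> is unknown but
  cancels when two good coordinates are compared: relative to one fixed good \<open>j\<close>, all
  phases are within 2/128 = 1/64 of 1.\<close>

lemma spectrum_structure:
  assumes p: "p > 0" and v: "v \<in> {..<n} \<rightarrow> {..<p}"
    and X: "X \<subseteq> spectrum n p q v" "card X \<le> l"
  shows "\<exists>E c. E \<subseteq> {..<n} \<and> card E \<le> l * q \<and> c < p \<and>
    (\<forall>i\<in>{..<n} - E. (v i + (p - c)) mod p \<in> bohr p X (1 / 64))"
proof -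
  let ?e = "\<lambda>x y. unit_char p (int (x * y))"
  have "\<forall>x\<in>X. \<exists>w. norm w = 1 \<and> card {i. i < n \<and> norm (1 - w * ?e x (v i)) > 1 / 128} \<le> q"
    using X(1) by (auto simp: spectrum_def)
  then obtain w where w: "\<And>x. x \<in> X \<Longrightarrow> norm (w x) = 1"
      "\<And>x. x \<in> X \<Longrightarrow> card {i. i < n \<and> norm (1 - w x * ?e x (v i)) > 1 / 128} \<le> q" by metis
  define E where "E = (\<Union>x\<in>X. {i. i < n \<and> norm (1 - w x * ?e x (v i)) > 1 / 128})"
  have fin: "finite X" using X(1) finite_subset by fastforce
  have "card E \<le> (\<Sum>x\<in>X. card {i. i < n \<and> norm (1 - w x * ?e x (v i)) > 1 / 128})"
    unfolding E_def using fin by (rule card_UN_le)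
  also have "\<dots> \<le> (\<Sum>x\<in>X. q)" by (intro sum_mono w)
  also have "\<dots> \<le> l * q" using X(2) by simp
  finally have E: "card E \<le> l * q" "E \<subseteq> {..<n}" by (auto simp: E_def)
  show ?thesis
  proof (cases "{..<n} - E = {}")
    case True
    thus ?thesis using E p by (intro exI[of _ E] exI[of _ 0]) auto
  next
    case False
    then obtain j where j: "j \<in> {..<n} - E" by blast
    define c where "c = v j"
    have c: "c < p" using j v by (auto simp: c_def)
    have "(v i + (p - c)) mod p \<in> bohr p X (1 / 64)" if i: "i \<in> {..<n} - E" for i
    proof -
      have "norm (?e x ((v i + (p - c)) mod p) - 1) \<le> 1 / 64" if x: "x \<in> X" for x
      proof -
        have "[int ((v i + (p - c)) mod p) = int (v i) - int c] (mod int p)"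
        proof -
          have "int (v i + (p - c)) = (int (v i) - int c) + int p" using c by simp
          thus ?thesis by (simp only: cong_def zmod_int mod_mod_trivial mod_add_self2)
        qed
        hence "[int x * int ((v i + (p - c)) mod p) = int x * (int (v i) - int c)] (mod int p)"
          by (rule cong_scalar_left)
        hence "?e x ((v i + (p - c)) mod p) = unit_char p (int x * (int (v i) - int c))"
          using unit_char_cong[OF p] by simp
        also have "\<dots> = ?e x (v i) * cnj (?e x c)"
          by (simp add: right_diff_distrib flip: unit_char_add unit_char_minus)
        finally have eq: "?e x ((v i + (p - c)) mod p) = ?e x (v i) * cnj (?e x c)" .
        have one: "cnj (?e x c) * ?e x c = 1"
          by (metis complex_norm_square mult.commute norm_unit_char of_real_1 one_power2)
        have "norm (?e x (v i) * cnj (?e x c) - 1) = norm (cnj (?e x c) * (?e x (v i) - ?e x c))"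
          using one by (simp add: right_diff_distrib mult.commute)
        also have "\<dots> = norm (w x * (?e x (v i) - ?e x c))"
          using w(1)[OF x] by (simp add: norm_mult)
        also have "\<dots> = norm ((1 - w x * ?e x c) - (1 - w x * ?e x (v i)))"
          by (simp add: algebra_simps)
        also have "\<dots> \<le> norm (1 - w x * ?e x c) + norm (1 - w x * ?e x (v i))"
          by (rule norm_triangle_ineq4)
        also have "\<dots> \<le> 1 / 128 + 1 / 128"
          using i j x by (intro add_mono) (auto simp: E_def c_def not_less)
        finally show ?thesis unfolding eq by simp
      qed
      thus ?thesis using p by (simp add: bohr_def)
    qed
    thus ?thesis using E c by blast
  qed
qed

text \<open>Covers the case of a trivial Bohr set, where its size gives no information. If
  \<open>v\<close> is constant, a vanishing sum is (n/2) * c, impossible as 0 < c < p and n < p.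
  Otherwise exchanging a coordinate \<open>i\<close> with \<open>v i \<noteq> c\<close> against one
  outside \<open>E\<close> destroys a vanishing sum, so vanishing sets cannot dominate the
  layer.\<close>

lemma card_zero_sets_nearly_constant:
  assumes n: "n > 0" "even n" and p: "prime p" "n < p" and v: "v \<in> {..<n} \<rightarrow> {..<p}"
    and E: "E \<subseteq> {..<n}" "4 * card E \<le> n"
    and c: "\<And>i. i \<in> {..<n} - E \<Longrightarrow> v i = c"
    and nz: "\<exists>i<n. v i \<noteq> 0"
  shows "5 * card (zero_sets n p v) \<le> 4 * card (layer n (n div 2))"
proof (cases "\<forall>i<n. v i = c")
  case True
  have c0: "c > 0" "c < p" using True nz v n by auto
  have "zero_sets n p v = {}"
  proof (rule ccontr)
    assume "zero_sets n p v \<noteq> {}"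
    then obtain A where A: "A \<subseteq> {..<n}" "card A = n div 2" "p dvd (\<Sum>i\<in>A. v i)"
      by (auto simp: zero_sets_def layer_def)
    have "(\<Sum>i\<in>A. v i) = (n div 2) * c" using A True by (simp add: subset_iff)
    hence "p dvd n div 2 \<or> p dvd c" using A p by (simp add: prime_dvd_mult_iff)
    thus False using c0 n p by (auto dest!: dvd_imp_le elim!: evenE)
  qed
  thus ?thesis by simp
next
  case False
  then obtain i where i: "i < n" "v i \<noteq> c" by blast
  let ?L = "layer n (n div 2)" and ?Z = "zero_sets n p v"
  define J where "J A = {j \<in> {..<n} - E. (j \<in> A) \<noteq> (i \<in> A)}" for A
  \<comment> \<open>Symmetric difference with the pair i, j. Carrying \<open>j\<close> along makes
    \<open>sw\<close> an involution, hence injective.\<close>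
  define sw where "sw = (\<lambda>(A :: nat set, j). ((A - {i, j}) \<union> ({i, j} - A), j))"
  have iE: "i \<in> E" using i c by blast
  have finE: "finite E" using E finite_subset by blast
  \<comment> \<open>\<open>A\<close> and its complement both have n/2 elements, of which at most n/4
    lie in \<open>E\<close>.\<close>
  have J: "n \<le> 4 * card (J A)" if A: "A \<in> ?L" for A
  proof -
    have A': "A \<subseteq> {..<n}" "card A = n div 2" using A by (auto simp: layer_def)
    define D where "D = (if i \<in> A then {..<n} - A else A)"
    have "card D = n div 2" using A' n by (auto simp: D_def card_Diff_subset finite_subset)
    moreover have "J A = D - E" using A' by (auto simp: J_def D_def)
    moreover have "card D - card E \<le> card (D - E)" using finE by (rule diff_card_le_card_Diff)
    ultimately show ?thesis using E n by (auto elim!: evenE)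
  qed
  have maps: "sw (A, j) \<in> (?L - ?Z) \<times> {..<n}" if A: "A \<in> ?Z" and j: "j \<in> J A" for A j
  proof -
    have A': "A \<subseteq> {..<n}" "card A = n div 2" "p dvd (\<Sum>i\<in>A. v i)"
      using A by (auto simp: zero_sets_def layer_def)
    have finA: "finite A" using A' finite_subset by blast
    have j': "j < n" "j \<noteq> i" "v j = c" using j iE c by (auto simp: J_def)
    have vp: "v i < p" "v j < p" using v i j' by auto
    have *: False if "p dvd s + v a" "p dvd s + v b" "{a, b} = {i, j}" for s a b
    proof -
      have "[s + v a = s + v b] (mod p)" using that by (simp add: cong_def mod_0_imp_dvd dvd_eq_mod_eq_0)
      hence "[v a = v b] (mod p)" by (simp add: cong_add_lcancel_nat)
      hence "v a = v b" using that(3) vp by (auto simp: doubleton_eq_iff intro: cong_less_modulus_unique_nat)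
      thus False using that(3) i j' by (auto simp: doubleton_eq_iff)
    qed
    have key: "(A - {a}) \<union> {b} \<in> ?L - ?Z" if ab: "a \<in> A" "b \<notin> A" "{a, b} = {i, j}" for a b
    proof -
      have "b < n" using ab i j' by (auto simp: doubleton_eq_iff)
      have "card A > 0" using ab finA by (auto simp: card_gt_0_iff)
      hence "card ((A - {a}) \<union> {b}) = n div 2" using ab finA A' by (simp add: card.insert_remove)
      hence L: "(A - {a}) \<union> {b} \<in> ?L" using A' \<open>b < n\<close> by (auto simp: layer_def)
      have "(\<Sum>k\<in>A. v k) = (\<Sum>k\<in>A - {a}. v k) + v a"
        using ab finA by (simp add: sum.remove)
      moreover have "(\<Sum>k\<in>(A - {a}) \<union> {b}. v k) = (\<Sum>k\<in>A - {a}. v k) + v b"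
        using ab finA by simp
      ultimately have "\<not> p dvd (\<Sum>k\<in>(A - {a}) \<union> {b}. v k)"
        using *[OF _ _ ab(3)] A'(3) by metis
      thus ?thesis using L by (simp add: zero_sets_def)
    qed
    show ?thesis
    proof (cases "i \<in> A")
      case True
      hence "j \<notin> A" using j by (auto simp: J_def)
      hence "(A - {i, j}) \<union> ({i, j} - A) = (A - {i}) \<union> {j}" using True by auto
      thus ?thesis using key[of i j] True \<open>j \<notin> A\<close> j' by (simp add: sw_def)
    next
      case False
      hence "j \<in> A" using j by (auto simp: J_def)
      hence "(A - {i, j}) \<union> ({i, j} - A) = (A - {j}) \<union> {i}" using False by auto
      thus ?thesis using key[of j i] False \<open>j \<in> A\<close> j' by (simp add: sw_def insert_commute)
    qed
  qed
  have finZ: "finite ?Z" by (simp add: zero_sets_def)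
  have finJ: "finite (J A)" for A by (simp add: J_def)
  have sub: "?Z \<subseteq> ?L" by (auto simp: zero_sets_def)
  have inj: "inj_on sw (Sigma ?Z J)"
    by (rule inj_on_inverseI[of _ sw]) (auto simp: sw_def)
  have "n * card ?Z = (\<Sum>A\<in>?Z. n)" by simp
  also have "\<dots> \<le> (\<Sum>A\<in>?Z. 4 * card (J A))"
    using J sub by (intro sum_mono) auto
  also have "\<dots> = 4 * card (Sigma ?Z J)"
    using finZ finJ by (simp add: sum_distrib_left)
  also have "card (Sigma ?Z J) \<le> card ((?L - ?Z) \<times> {..<n})"
  proof (rule card_inj_on_le[OF inj])
    show "sw ` Sigma ?Z J \<subseteq> (?L - ?Z) \<times> {..<n}" using maps by blast
  qed simp
  also have "\<dots> = n * (card ?L - card ?Z)"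
    using sub by (simp add: card_cartesian_product card_Diff_subset[OF finZ])
  finally have "n * card ?Z \<le> n * (4 * (card ?L - card ?Z))" by simp
  hence "card ?Z \<le> 4 * (card ?L - card ?Z)" using n by simp
  thus ?thesis using card_mono[OF finite_layer sub] by linarith
qed

section \<open>Counting the vectors with a large spectrum\<close>

lemma card_small_subsets_le:
  assumes "finite U"
  shows "finite {X. X \<subseteq> U \<and> card X \<le> l} \<and> card {X. X \<subseteq> U \<and> card X \<le> l} \<le> (card U + 1) ^ l"
proof (induction l)
  case 0
  have "{X. X \<subseteq> U \<and> card X \<le> 0} = {{}}"
    using assms by (auto simp: card_eq_0_iff dest: finite_subset)
  thus ?case by simp
next
  case (Suc l)
  let ?F = "\<lambda>l. {X. X \<subseteq> U \<and> card X \<le> l}"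
  have "?F (Suc l) \<subseteq> ?F l \<union> (\<lambda>(x, X). insert x X) ` (U \<times> ?F l)"
  proof
    fix X assume X: "X \<in> ?F (Suc l)"
    hence fin: "finite X" using assms finite_subset by blast
    show "X \<in> ?F l \<union> (\<lambda>(x, X). insert x X) ` (U \<times> ?F l)"
    proof (cases "X = {}")
      case False
      then obtain x where x: "x \<in> X" by blast
      have "X = (\<lambda>(x, X). insert x X) (x, X - {x})" using x by auto
      moreover have "(x, X - {x}) \<in> U \<times> ?F l" using X x fin by auto
      ultimately show ?thesis by (intro UnI2) (rule image_eqI)
    qed simp
  qed
  moreover have fin: "finite (?F l \<union> (\<lambda>(x, X). insert x X) ` (U \<times> ?F l))"
    using Suc assms by simp
  ultimately have "card (?F (Suc l)) \<le> card (?F l \<union> (\<lambda>(x, X). insert x X) ` (U \<times> ?F l))"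
    by (intro card_mono)
  also have "\<dots> \<le> card (?F l) + card ((\<lambda>(x, X). insert x X) ` (U \<times> ?F l))"
    by (rule card_Un_le)
  also have "card ((\<lambda>(x, X). insert x X) ` (U \<times> ?F l)) \<le> card U * card (?F l)"
    using card_image_le[of "U \<times> ?F l" "\<lambda>(x, X). insert x X"] Suc assms
    by (simp add: card_cartesian_product)
  also have "card (?F l) + card U * card (?F l) = (card U + 1) * card (?F l)" by simp
  also have "\<dots> \<le> (card U + 1) * (card U + 1) ^ l" using Suc by (intro mult_le_mono2) simp
  finally show ?case using assms by simp
qed

lemma sum_UN_le:
  fixes f :: "'a \<Rightarrow> real"
  assumes "finite I" "\<And>i. i \<in> I \<Longrightarrow> finite (V i)" "\<And>x. f x \<ge> 0"
  shows "sum f (\<Union>i\<in>I. V i) \<le> (\<Sum>i\<in>I. sum f (V i))"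
  using assms(1,2)
proof (induction I rule: finite_induct)
  case (insert i I)
  have "sum f (V i \<union> (\<Union>i\<in>I. V i)) = sum f (V i) + sum f (\<Union>i\<in>I. V i) - sum f (V i \<inter> (\<Union>i\<in>I. V i))"
    using insert by (intro sum_Un) auto
  also have "\<dots> \<le> sum f (V i) + sum f (\<Union>i\<in>I. V i)"
    using assms(3) by (simp add: sum_nonneg)
  also have "\<dots> \<le> sum f (V i) + (\<Sum>i\<in>I. sum f (V i))" using insert by simp
  finally show ?case using insert by simp
qed simp

definition zero_prob :: "nat \<Rightarrow> nat \<Rightarrow> (nat \<Rightarrow> nat) \<Rightarrow> real" where
  "zero_prob n p v = real (card (zero_sets n p v)) / real (card (layer n (n div 2)))"

lemma card_layer_pos: "card (layer n (n div 2)) > 0"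
  by (simp add: card_layer zero_less_binomial_iff)

lemma zero_prob_nonneg: "0 \<le> zero_prob n p v"
  by (simp add: zero_prob_def)

lemma zero_prob_le_spectrum:
  assumes n: "n > 0" "even n" and p: "p > 0"
    and q: "real n * real p * (1 - 1 / 131072) ^ q \<le> 1"
  shows "real p * zero_prob n p v \<le> 2 * real (card (spectrum n p q v))"
  using card_zero_sets_le'[OF assms, of v] card_layer_pos[of n]
  by (simp add: zero_prob_def divide_le_eq)

text \<open>Adding \<open>p - c\<close> is subtraction of \<open>c\<close> modulo \<open>p\<close>
  within the naturals. Functions are extensional so that the set is finite and a union bound can
  range over it.\<close>

definition bohr_vectors :: "nat \<Rightarrow> nat \<Rightarrow> nat set \<Rightarrow> nat set \<Rightarrow> nat \<Rightarrow> (nat \<Rightarrow> nat) set" where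
  "bohr_vectors n p X E c = {v \<in> {..<n} \<rightarrow>\<^sub>E {..<p}.
     \<forall>i\<in>{..<n} - E. (v i + (p - c)) mod p \<in> bohr p X (1 / 64)}"

lemma finite_bohr_vectors [simp]: "finite (bohr_vectors n p X E c)"
  unfolding bohr_vectors_def by (rule finite_subset[of _ "{..<n} \<rightarrow>\<^sub>E {..<p}"]) (auto intro: finite_PiE)

lemma card_bohr_vectors_le:
  assumes p: "p > 0" and E: "E \<subseteq> {..<n}" "card E \<le> k"
  shows "card (bohr_vectors n p X E c) \<le> p ^ k * card (bohr p X (1 / 64)) ^ n"
proof -
  let ?B = "bohr p X (1 / 64)"
  define T where "T = {y. y < p \<and> (y + (p - c)) mod p \<in> ?B}"
  have "inj_on (\<lambda>y. (y + (p - c)) mod p) T"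
  proof (rule inj_onI)
    fix x y assume "x \<in> T" "y \<in> T" "(x + (p - c)) mod p = (y + (p - c)) mod p"
    hence "[x + (p - c) = y + (p - c)] (mod p)" "x < p" "y < p" by (auto simp: cong_def T_def)
    thus "x = y" by (simp add: cong_add_rcancel_nat cong_less_modulus_unique_nat)
  qed
  hence T: "card T \<le> card ?B" by (rule card_inj_on_le) (auto simp: T_def)
  have "bohr_vectors n p X E c \<subseteq> (\<Pi>\<^sub>E i\<in>{..<n}. if i \<in> E then {..<p} else T)"
    by (auto simp: bohr_vectors_def T_def PiE_iff extensional_def)
  hence "card (bohr_vectors n p X E c) \<le> card (\<Pi>\<^sub>E i\<in>{..<n}. if i \<in> E then {..<p} else T)"
    by (intro card_mono finite_PiE) (auto simp: T_def)
  also have "\<dots> = (\<Prod>i<n. if i \<in> E then p else card T)"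
    by (subst card_PiE) (auto intro!: prod.cong)
  also have "\<dots> = p ^ card E * card T ^ card ({..<n} - E)"
  proof -
    have "{..<n} \<inter> E = E" "{..<n} \<inter> - E = {..<n} - E" using E by auto
    thus ?thesis by (simp add: prod.If_cases)
  qed
  also have "\<dots> \<le> p ^ k * card ?B ^ n"
  proof (intro mult_le_mono)
    show "p ^ card E \<le> p ^ k" using E p by (intro power_increasing) auto
    have "card T ^ card ({..<n} - E) \<le> card ?B ^ card ({..<n} - E)" using T by (rule power_mono) simp
    also have "\<dots> \<le> card ?B ^ n"
    proof (rule power_increasing)
      show "card ({..<n} - E) \<le> n" using card_mono[of "{..<n}" "{..<n} - E"] by auto
      show "1 \<le> card ?B" using card_bohr_pos[OF p, of "1 / 64" X] by linarith
    qed
    finally show "card T ^ card ({..<n} - E) \<le> card ?B ^ n" .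
  qed
  finally show ?thesis .
qed

text \<open>The threshold 5 suits both sides: up to 4 frequencies give vanishing probability at most
  8 / p, while 5 or more leave at most 4p/5 < p residues with a large Fourier coefficient, so that
  Bohr sets can be doubled.\<close>

definition structured :: "nat \<Rightarrow> nat \<Rightarrow> nat \<Rightarrow> (nat \<Rightarrow> nat) set" where
  "structured n p q =
     {v \<in> {..<n} \<rightarrow>\<^sub>E {..<p}. (\<exists>i<n. v i \<noteq> 0) \<and> card (spectrum n p q v) \<ge> 5}"

lemma finite_structured [simp]: "finite (structured n p q)"
  unfolding structured_def by (rule finite_subset[of _ "{..<n} \<rightarrow>\<^sub>E {..<p}"]) (auto intro: finite_PiE)

text \<open>
  A Bohr set of size \<open>b\<close> costs a factor \<open>b\<close> per coordinate in the count of vectors but forces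
  \<open>b\<close> times the vanishing probability below a constant less than \<open>1\<close>.
\<close>

lemma structured_in_bohr_vectors:
  assumes n: "n > 0" "even n" and p: "prime p" "n < p"
    and q: "real n * real p * (1 - 1 / 131072) ^ q \<le> 1"
    and l: "(7 / 8) ^ l * real p < 1" and lq: "4 * (l * q) \<le> n"
    and v: "v \<in> structured n p q"
  shows "\<exists>X E c. X \<subseteq> {..<p} \<and> card X \<le> l \<and> E \<subseteq> {..<n} \<and> card E \<le> l * q \<and> c < p \<and>
     v \<in> bohr_vectors n p X E c \<and> real (card (bohr p X (1 / 64))) * zero_prob n p v \<le> 4 / 5"
proof -
  have p0: "p > 0" using p by simp
  let ?S = "spectrum n p q v"
  have v': "v \<in> {..<n} \<rightarrow>\<^sub>E {..<p}" "\<exists>i<n. v i \<noteq> 0" "card ?S \<ge> 5"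
    using v by (auto simp: structured_def)
  hence v'': "v \<in> {..<n} \<rightarrow> {..<p}" by auto
  obtain X where X: "X \<subseteq> ?S" "card X \<le> l"
      and b: "32 * (card (bohr p X (1 / 64)) - 1) * card ?S \<le> 4 * p"
    using exists_small_bohr[OF p(1) spectrum_subset v'(3) l] by blast
  obtain E c where E: "E \<subseteq> {..<n}" "card E \<le> l * q" and c: "c < p"
      and *: "\<forall>i\<in>{..<n} - E. (v i + (p - c)) mod p \<in> bohr p X (1 / 64)"
    using spectrum_structure[OF p0 v'' X] by blast
  define b where "b = card (bohr p X (1 / 64))"
  have "b > 0" unfolding b_def by (intro card_bohr_pos p0) simp
  \<comment> \<open>For \<open>b = 1\<close> the estimate on \<open>b - 1\<close> is void, but then
    \<open>v\<close> is constant outside \<open>E\<close> and the exchange argument gives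
    4/5.\<close>
  have "real b * zero_prob n p v \<le> 4 / 5"
  proof (cases "b = 1")
    case True
    hence B: "bohr p X (1 / 64) = {0}"
      using zero_in_bohr[OF p0, of "1 / 64" X] by (auto simp: b_def card_1_singleton_iff)
    have "5 * card (zero_sets n p v) \<le> 4 * card (layer n (n div 2))"
    proof (rule card_zero_sets_nearly_constant[OF n p v'' E(1)])
      show "4 * card E \<le> n" using E lq by linarith
      fix i assume i: "i \<in> {..<n} - E"
      hence "(v i + (p - c)) mod p = 0" using * B by auto
      hence "[v i + (p - c) + c = 0 + c] (mod p)" by (simp only: cong_add_rcancel_nat) (simp add: cong_def)
      hence "[v i = c] (mod p)" using c by (simp add: cong_def)
      thus "v i = c" using c i v'' by (auto intro: cong_less_modulus_unique_nat)
    qed (rule v'(2))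
    hence "5 * real (card (zero_sets n p v)) \<le> 4 * real (card (layer n (n div 2)))" by linarith
    thus ?thesis using True card_layer_pos[of n] by (simp add: zero_prob_def divide_le_eq)
  next
    case False
    \<comment> \<open>From \<open>b \<ge> 2\<close> on, \<open>b - 1\<close> may be replaced by b/2;
      the product is then at most 1/2, below the 4/5 of the other case.\<close>
    hence "b \<le> 2 * (b - 1)" using \<open>b > 0\<close> by simp
    hence "16 * b * card ?S \<le> 32 * (b - 1) * card ?S" by (intro mult_le_mono1) simp
    hence "16 * b * card ?S \<le> 4 * p" using b unfolding b_def by (rule order_trans)
    hence "real (16 * b * card ?S) \<le> real (4 * p)" by (rule of_nat_mono)
    hence bs: "real b * (2 * real (card ?S)) \<le> real p / 2" by simp
    have "real p * (real b * zero_prob n p v) = real b * (real p * zero_prob n p v)" by simp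
    also have "\<dots> \<le> real b * (2 * real (card ?S))"
      by (intro mult_left_mono zero_prob_le_spectrum n p0 q) auto
    also have "\<dots> \<le> real p * (4 / 5)" using bs p0 by simp
    finally show ?thesis using p0 by simp
  qed
  moreover have "v \<in> bohr_vectors n p X E c" using * v'(1) by (simp add: bohr_vectors_def)
  moreover have "X \<subseteq> {..<p}" using X(1) spectrum_subset by blast
  ultimately show ?thesis using X(2) E c unfolding b_def by blast
qed

text \<open>One triple (X, E, c) admits at most p^(lq) * b^n vectors, each contributing at most
  (4/(5b))^(n-1). All powers of b cancel except one, which is bounded by \<open>p\<close>; hence the
  exponent \<open>l * q + 1\<close>.\<close>

theorem sum_structured_le:
  assumes n: "n > 0" "even n" and p: "prime p" "n < p"
    and q: "real n * real p * (1 - 1 / 131072) ^ q \<le> 1"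
    and l: "(7 / 8) ^ l * real p < 1" and lq: "4 * (l * q) \<le> n"
  shows "(\<Sum>v\<in>structured n p q. zero_prob n p v ^ (n - 1)) \<le>
     real ((p + 1) ^ l * ((n + 1) ^ (l * q) * p) * p ^ (l * q + 1)) * (4 / 5) ^ (n - 1)"
proof -
  have p0: "p > 0" using p by simp
  let ?b = "\<lambda>X. card (bohr p X (1 / 64))"
  define I where "I = {X. X \<subseteq> {..<p} \<and> card X \<le> l} \<times> ({E. E \<subseteq> {..<n} \<and> card E \<le> l * q} \<times> {..<p})"
  \<comment> \<open>The probability bound is a separate condition, since it comes from the spectrum
    of \<open>v\<close> and is not part of \<open>bohr_vectors\<close>.\<close>
  define V where "V = (\<lambda>(X, E, c). {v \<in> bohr_vectors n p X E c. real (?b X) * zero_prob n p v \<le> 4 / 5})"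
  have finI: "finite I"
    unfolding I_def using card_small_subsets_le[of "{..<p}" l] card_small_subsets_le[of "{..<n}" "l * q"]
    by simp
  have cardI: "card I \<le> (p + 1) ^ l * ((n + 1) ^ (l * q) * p)"
    unfolding I_def card_cartesian_product card_lessThan
    using card_small_subsets_le[of "{..<p}" l] card_small_subsets_le[of "{..<n}" "l * q"]
    by (intro mult_le_mono) auto
  have finV: "finite (V i)" for i by (cases i) (simp add: V_def)
  have cover: "structured n p q \<subseteq> (\<Union>i\<in>I. V i)"
  proof
    fix v assume "v \<in> structured n p q"
    from structured_in_bohr_vectors[OF n p q l lq this] obtain X E c where
      "(X, E, c) \<in> I" "v \<in> V (X, E, c)" unfolding I_def V_def by auto
    thus "v \<in> (\<Union>i\<in>I. V i)" by blast
  qed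
  have each: "(\<Sum>v\<in>V i. zero_prob n p v ^ (n - 1)) \<le> real (p ^ (l * q + 1)) * (4 / 5) ^ (n - 1)"
    if i: "i \<in> I" for i
  proof -
    obtain X E c where i': "i = (X, E, c)" "E \<subseteq> {..<n}" "card E \<le> l * q" using i by (auto simp: I_def)
    have b0: "?b X > 0" by (intro card_bohr_pos p0) simp
    have bp: "?b X \<le> p" using card_mono[OF _ bohr_subset[of p X "1 / 64"]] by simp
    have "zero_prob n p v ^ (n - 1) \<le> (4 / 5 / real (?b X)) ^ (n - 1)" if "v \<in> V i" for v
      using that b0 by (intro power_mono zero_prob_nonneg) (auto simp: V_def i' field_simps)
    hence "(\<Sum>v\<in>V i. zero_prob n p v ^ (n - 1)) \<le> (\<Sum>v\<in>V i. (4 / 5 / real (?b X)) ^ (n - 1))"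
      by (rule sum_mono)
    also have "\<dots> = real (card (V i)) * (4 / 5 / real (?b X)) ^ (n - 1)" by simp
    also have "card (V i) \<le> card (bohr_vectors n p X E c)"
      by (intro card_mono) (auto simp: V_def i')
    hence "card (V i) \<le> p ^ (l * q) * ?b X ^ n"
      using card_bohr_vectors_le[OF p0 i'(2,3), of X c] by linarith
    hence "real (card (V i)) * (4 / 5 / real (?b X)) ^ (n - 1) \<le>
        real (p ^ (l * q) * ?b X ^ n) * (4 / 5 / real (?b X)) ^ (n - 1)"
      by (intro mult_right_mono of_nat_mono) auto
    also have "\<dots> = real (p ^ (l * q)) * real (?b X) * (4 / 5) ^ (n - 1)"
    proof -
      have "real (?b X ^ n) = real (?b X) * real (?b X) ^ (n - 1)"
        using n by (metis of_nat_power power_eq_if not_gr_zero)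
      thus ?thesis using b0 by (simp add: power_divide)
    qed
    also have "\<dots> \<le> real (p ^ (l * q)) * real p * (4 / 5) ^ (n - 1)"
      using bp by (intro mult_right_mono mult_left_mono) auto
    finally show ?thesis by (simp add: mult.commute)
  qed
  have "(\<Sum>v\<in>structured n p q. zero_prob n p v ^ (n - 1)) \<le> (\<Sum>v\<in>(\<Union>i\<in>I. V i). zero_prob n p v ^ (n - 1))"
    using finI finV cover by (intro sum_mono2) (auto simp: zero_prob_nonneg)
  also have "\<dots> \<le> (\<Sum>i\<in>I. \<Sum>v\<in>V i. zero_prob n p v ^ (n - 1))"
    using finI finV by (intro sum_UN_le) (auto simp: zero_prob_nonneg)
  also have "\<dots> \<le> (\<Sum>i\<in>I. real (p ^ (l * q + 1)) * (4 / 5) ^ (n - 1))"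
    by (intro sum_mono each)
  also have "\<dots> = real (card I) * (real (p ^ (l * q + 1)) * (4 / 5) ^ (n - 1))" by simp
  also have "\<dots> \<le> real ((p + 1) ^ l * ((n + 1) ^ (l * q) * p)) * (real (p ^ (l * q + 1)) * (4 / 5) ^ (n - 1))"
    using cardI by (intro mult_right_mono of_nat_mono) auto
  finally show ?thesis by simp
qed

subsection \<open>Primes of polynomial size\<close>

text \<open>Chebyshev's identity, by writing each ln k as a divisor sum and counting multiples.
  Terms with d > n vanish, so the range may extend to any \<open>Y \<ge> n\<close>; this lets two
  factorials share one range.\<close>

lemma ln_fact_mangoldt:
  assumes "n \<le> Y"
  shows "ln (fact n :: real) = (\<Sum>d\<in>{1..Y}. mangoldt d * real (n div d))"
proof -
  have "ln (fact n :: real) = ln (\<Prod>k\<in>{1..n}. real k)"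
    by (simp add: fact_prod)
  also have "\<dots> = (\<Sum>k\<in>{1..n}. ln (real k))" by (rule ln_prod) auto
  also have "\<dots> = (\<Sum>k\<in>{1..n}. \<Sum>d\<in>{1..Y}. if d dvd k then mangoldt d else 0)"
  proof (rule sum.cong[OF refl])
    fix k assume k: "k \<in> {1..n}"
    have "{d \<in> {1..Y}. d dvd k} = {d. d dvd k}"
      using k assms by (auto intro: Suc_leI dvd_pos_nat dest: dvd_imp_le)
    thus "ln (real k) = (\<Sum>d\<in>{1..Y}. if d dvd k then mangoldt d else 0)"
      using k mangoldt_sum[of k, where ?'a = real] by (simp add: sum.inter_filter[symmetric])
  qed
  also have "\<dots> = (\<Sum>d\<in>{1..Y}. \<Sum>k\<in>{1..n}. if d dvd k then mangoldt d else 0)"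
    by (rule sum.swap)
  also have "\<dots> = (\<Sum>d\<in>{1..Y}. mangoldt d * real (n div d))"
  proof (rule sum.cong[OF refl])
    fix d assume d: "d \<in> {1..Y}"
    have "{k \<in> {1..n}. d dvd k} = (\<lambda>j. d * j) ` {1..n div d}"
    proof safe
      fix k assume "k \<in> {1..n}" "d dvd k"
      then obtain j where "k = d * j" by blast
      thus "k \<in> (\<lambda>j. d * j) ` {1..n div d}"
        using \<open>k \<in> {1..n}\<close> d by (auto simp: less_eq_div_iff_mult_less_eq mult.commute)
    qed (use d in \<open>auto simp: less_eq_div_iff_mult_less_eq mult.commute\<close>)
    moreover have "inj_on (\<lambda>j. d * j) {1..n div d}" using d by (auto simp: inj_on_def)
    ultimately have "card {k \<in> {1..n}. d dvd k} = n div d" by (simp add: card_image)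
    thus "(\<Sum>k\<in>{1..n}. if d dvd k then mangoldt d else 0) = mangoldt d * real (n div d)"
      by (simp add: sum.inter_filter[symmetric])
  qed
  finally show ?thesis .
qed

text \<open>In the quotient of factorials each \<open>mangoldt d\<close> is weighted by floor(2M/d)
  - 2 floor(M/d), which is at most 1.\<close>

lemma ln_central_binomial_le:
  "ln (real (2 * M choose M)) \<le> (\<Sum>d\<in>{1..2 * M}. mangoldt d)"
proof -
  have "real (2 * M choose M) = fact (2 * M) / (fact M * fact M)"
    by (subst binomial_fact) auto
  hence "ln (real (2 * M choose M)) = ln (fact (2 * M)) - 2 * ln (fact M)"
    by (simp add: ln_div ln_mult)
  also have "\<dots> = (\<Sum>d\<in>{1..2 * M}. mangoldt d * (real ((2 * M) div d) - 2 * real (M div d)))"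
    by (simp add: ln_fact_mangoldt[of _ "2 * M"] sum_subtractf sum_distrib_left right_diff_distrib mult_ac)
  also have "\<dots> \<le> (\<Sum>d\<in>{1..2 * M}. mangoldt d * 1)"
  proof (intro sum_mono mult_left_mono mangoldt_nonneg)
    fix d assume d: "d \<in> {1..2 * M}"
    have "(2 * M) div d < 2 * (M div d) + 2"
    proof -
      have "M < d * (M div d + 1)" using d dividend_less_div_times[of d M] by (simp add: mult.commute)
      hence "2 * M < (2 * (M div d) + 2) * d" by (simp add: algebra_simps)
      thus ?thesis using d by (simp add: div_less_iff_less_mult)
    qed
    thus "real ((2 * M) div d) - 2 * real (M div d) \<le> 1" by linarith
  qed
  finally show ?thesis by simp
qed

text \<open>Without primes above \<open>N\<close>, only prime powers \<open>q ^ k\<close> with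
  \<open>q \<le> N\<close> and \<open>k < L\<close> contribute, each at most
  \<open>ln N\<close>.\<close>

lemma sum_mangoldt_le_of_no_primes:
  assumes no: "\<And>p. prime p \<Longrightarrow> N < p \<Longrightarrow> p \<le> Y \<Longrightarrow> False" and L: "Y < 2 ^ L" and N: "N > 0"
  shows "(\<Sum>d\<in>{1..Y}. mangoldt d) \<le> real N * real L * ln (real N)"
proof -
  define D where "D = {d \<in> {1..Y}. primepow d}"
  have D: "d \<in> (\<lambda>(q, k). q ^ k) ` ({1..N} \<times> {..<L}) \<and> mangoldt d \<le> ln (real N)" if d: "d \<in> D" for d
  proof -
    let ?q = "aprimedivisor d"
    have pp: "primepow d" "d \<le> Y" "d \<ge> 1" using d by (auto simp: D_def)
    hence d1: "d > 1" using primepow_gt_Suc_0 by fastforce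
    have q: "prime ?q" using d1 by (intro prime_aprimedivisor') auto
    have "?q dvd d" using d1 by (intro aprimedivisor_dvd') auto
    hence "?q \<le> d" using d1 by (intro dvd_imp_le) auto
    hence qN: "?q \<le> N" using no[OF q] pp by (meson leI le_trans)
    obtain k where k: "d = ?q ^ k" using primepow_decompose[OF pp(1)] by metis
    have "(2::nat) ^ k \<le> ?q ^ k" using prime_ge_2_nat[OF q] by (rule power_mono) simp
    also have "\<dots> < 2 ^ L" using k pp L by linarith
    finally have "k < L" by simp
    hence "d \<in> (\<lambda>(q, k). q ^ k) ` ({1..N} \<times> {..<L})"
      using k qN prime_ge_1_nat[OF q] by (intro image_eqI[of _ _ "(?q, k)"]) auto
    moreover have "mangoldt d \<le> ln (real N)"
      using pp qN prime_gt_0_nat[OF q] by (simp add: mangoldt_def)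
    ultimately show ?thesis ..
  qed
  have "(\<Sum>d\<in>{1..Y}. mangoldt d) = (\<Sum>d\<in>D. mangoldt d :: real)"
    unfolding D_def by (intro sum.mono_neutral_right) (auto simp: mangoldt_def)
  also have "\<dots> \<le> (\<Sum>d\<in>D. ln (real N))" by (intro sum_mono) (use D in blast)
  also have "\<dots> = real (card D) * ln (real N)" by simp
  also have "card D \<le> card ((\<lambda>(q, k). q ^ k) ` ({1..N} \<times> {..<L}))"
    by (intro card_mono) (use D in auto)
  hence "card D \<le> N * L"
    using card_image_le[of "{1..N} \<times> {..<L}" "\<lambda>(q, k). q ^ k"] by (simp add: card_cartesian_product)
  hence "real (card D) * ln (real N) \<le> real (N * L) * ln (real N)"
    using N by (intro mult_right_mono of_nat_mono) auto
  finally show ?thesis by simp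
qed

text \<open>A weak Bertrand postulate: the central binomial coefficient makes Chebyshev's function
  at 2N^2 grow like N^2, while powers of primes up to \<open>N\<close> account for only O(N log^2
  N). The squared range is harmless, because \<open>p\<close> need only be polynomial in n.\<close>

lemma eventually_prime_between:
  "eventually (\<lambda>N. \<exists>p. prime p \<and> N < p \<and> p \<le> 2 * N\<^sup>2) sequentially"
proof -
  have "eventually (\<lambda>N::nat. real N ^ 2 * ln 4 - ln (2 * real N ^ 2) >
      real N * (log 2 (2 * real N ^ 2) + 1) * ln (real N)) sequentially"
    by real_asymp
  thus ?thesis
  proof (eventually_elim)
    case (elim N)
    have N: "N > 0" using elim by (cases "N = 0") auto
    define L where "L = floor_log (2 * N\<^sup>2) + 1"
    have L: "2 * N\<^sup>2 < 2 ^ L" unfolding L_def using floor_log_exp2_gt[of "2 * N\<^sup>2"] by simp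
    have "real (floor_log (2 * N\<^sup>2)) \<le> log 2 (real (2 * N\<^sup>2))"
    proof (rule le_log_of_power)
      have "2 ^ floor_log (2 * N\<^sup>2) \<le> 2 * N\<^sup>2" using N by (intro floor_log_exp2_le) simp
      hence "real (2 ^ floor_log (2 * N\<^sup>2)) \<le> real (2 * N\<^sup>2)" by (rule of_nat_mono)
      thus "2 ^ floor_log (2 * N\<^sup>2) \<le> real (2 * N\<^sup>2)" by simp
    qed simp
    hence Lr: "real L \<le> log 2 (2 * real N ^ 2) + 1" by (simp add: L_def)
    show ?case
    proof (rule ccontr)
      assume "\<not> ?thesis"
      hence no: "\<And>p. prime p \<Longrightarrow> N < p \<Longrightarrow> p \<le> 2 * N\<^sup>2 \<Longrightarrow> False" by blast
      have "4 ^ N\<^sup>2 / (2 * real (N\<^sup>2)) \<le> real (2 * N\<^sup>2 choose N\<^sup>2)"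
        using N by (intro central_binomial_lower_bound) simp
      hence "ln (4 ^ N\<^sup>2 / (2 * real (N\<^sup>2))) \<le> ln (real (2 * N\<^sup>2 choose N\<^sup>2))"
        using N by (subst ln_le_cancel_iff) auto
      also have "\<dots> \<le> (\<Sum>d\<in>{1..2 * N\<^sup>2}. mangoldt d)" by (rule ln_central_binomial_le)
      also have "\<dots> \<le> real N * real L * ln (real N)"
        by (rule sum_mangoldt_le_of_no_primes[OF no L N])
      also have "\<dots> \<le> real N * (log 2 (2 * real N ^ 2) + 1) * ln (real N)"
        using Lr N by (intro mult_right_mono mult_left_mono) auto
      finally have "ln (4 ^ N\<^sup>2 / (2 * real (N\<^sup>2))) \<le> \<dots>" .
      moreover have "ln (4 ^ N\<^sup>2 / (2 * real (N\<^sup>2))) = real N ^ 2 * ln 4 - ln (2 * real N ^ 2)"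
        using N by (simp add: ln_div ln_realpow)
      ultimately show False using elim by linarith
    qed
  qed
qed

subsection \<open>Linear dependencies modulo a prime\<close>

text \<open>Turns a 0/1 row into a set, so that its inner products become subset sums, which make
  sense modulo \<open>p\<close>.\<close>

definition vec_support :: "real Matrix.vec \<Rightarrow> nat set" where
  "vec_support x = {k. k < dim_vec x \<and> vec_index x k = 1}"

lemma span_orthogonal:
  assumes S: "S \<subseteq> carrier_vec n" and y: "y \<in> carrier_vec n"
    and orth: "\<And>s. s \<in> S \<Longrightarrow> scalar_prod s y = 0" and x: "x \<in> span_vec n S"
  shows "scalar_prod x y = 0"
proof -
  interpret vec_space "TYPE(real)" n .
  define W where "W = {x \<in> carrier_vec n. scalar_prod x y = 0}"
  have "submodule class_ring W (module_vec TYPE(real) n)"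
    using y vec_module[where ?'a = real]
    by unfold_locales
      (auto simp: W_def module_vec_simps add_scalar_prod_distrib[of _ n] class_ring_simps)
  moreover have "S \<subseteq> W" using S orth by (auto simp: W_def)
  ultimately have "span_vec n S \<subseteq> W" by (intro span_is_subset)
  thus ?thesis using x by (auto simp: W_def)
qed

lemma in_span_imp_det_0:
  fixes M :: "real Matrix.mat"
  assumes M: "M \<in> carrier_mat n n" and m: "m < n"
    and span: "Matrix.row M m \<in> span_vec n (Matrix.row M ` {..<m})"
  shows "Determinant.det M = 0"
proof (rule ccontr)
  assume det: "Determinant.det M \<noteq> 0"
  \<comment> \<open>\<open>M\<close> times this column of the adjugate is det M times a unit vector:
    \<open>y\<close> is orthogonal to every row except row \<open>m\<close>.\<close>
  define y where "y = Matrix.col (adj_mat M) m"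
  have adj: "adj_mat M \<in> carrier_mat n n" "M * adj_mat M = Determinant.det M \<cdot>\<^sub>m 1\<^sub>m n"
    using adj_mat[OF M] by auto
  have prod: "scalar_prod (Matrix.row M i) y = (if i = m then Determinant.det M else 0)" if "i < n" for i
  proof -
    have "scalar_prod (Matrix.row M i) y = (M * adj_mat M) $$ (i, m)"
      using that m M adj(1) by (simp add: y_def)
    thus ?thesis using that m by (simp add: adj(2))
  qed
  have "scalar_prod (Matrix.row M m) y = 0"
  proof (rule span_orthogonal[OF _ _ _ span])
    show "y \<in> carrier_vec n" using adj(1) m by (simp add: y_def)
    show "scalar_prod s y = 0" if "s \<in> Matrix.row M ` {..<m}" for s
      using that prod m by auto
  qed (use M m in auto)
  thus False using prod[OF m] det by simp
qed

text \<open>Dividing an integer relation by the gcd of its coefficients keeps it nontrivial after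
  reduction modulo \<open>p\<close>.\<close>

lemma primitive_multiple:
  fixes w :: "nat \<Rightarrow> int" and p :: nat
  assumes p: "prime p" and w: "\<exists>a<n. w a \<noteq> 0"
  shows "\<exists>g u. g \<noteq> 0 \<and> (\<forall>a<n. w a = g * u a) \<and> (\<exists>a<n. \<not> int p dvd u a)"
proof -
  define g where "g = Gcd (w ` {..<n})"
  have g0: "g \<noteq> 0" using w by (auto simp: g_def Gcd_0_iff)
  have dvd: "g dvd w a" if "a < n" for a using that by (auto simp: g_def)
  have "\<exists>a<n. \<not> int p dvd w a div g"
  proof (rule ccontr)
    assume "\<not> ?thesis"
    hence "int p * g dvd w a" if "a < n" for a
      using dvd[OF that] that g0 by (metis dvd_mult_div_cancel mult.commute mult_dvd_mono dvd_refl)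
    hence "int p * g dvd g" unfolding g_def[symmetric] by (subst (2) g_def) (auto intro!: Gcd_greatest)
    hence "int p dvd 1" using g0 by simp
    thus False using p by (auto simp: prime_nat_iff)
  qed
  thus ?thesis using g0 dvd by (intro exI[of _ g] exI[of _ "\<lambda>a. w a div g"]) auto
qed

text \<open>The integer 0/1 matrix is singular, so its rows satisfy a primitive integer relation,
  and \<open>i\<close> is a row whose coefficient is not divisible by \<open>p\<close>. The subset
  sums of any \<open>v\<close> obey the same relation. Testing against all \<open>v\<close> replaces
  linear algebra over the field with p elements; note that \<open>i\<close> is fixed before
  \<open>v\<close>.\<close>

lemma modular_row_dependency:
  fixes p :: nat
  assumes r: "\<And>i. i \<in> {1..n} \<Longrightarrow> r i \<in> balanced_vecs n" and m: "m < n"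
    and span: "r (m + 1) \<in> span_vec n (r ` {1..m})" and p: "prime p"
  shows "\<exists>i\<in>{1..n}. \<forall>v :: nat \<Rightarrow> nat. (\<forall>j\<in>{1..n} - {i}. p dvd (\<Sum>k\<in>vec_support (r j). v k)) \<longrightarrow>
    p dvd (\<Sum>k\<in>vec_support (r i). v k)"
proof -
  \<comment> \<open>Matrix rows are counted from 0: row \<open>a\<close> is
    \<open>r (a + 1)\<close>, so \<open>r (m + 1)\<close> is row \<open>m\<close> and
    \<open>r 1\<close>, ..., \<open>r m\<close> are the rows before it.\<close>
  define M :: "int Matrix.mat" where
    "M = Matrix.mat n n (\<lambda>(a, b). if b \<in> vec_support (r (a + 1)) then 1 else 0)"
  have M: "M \<in> carrier_mat n n" by (simp add: M_def)
  let ?R = "map_mat real_of_int M"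
  have dim: "dim_vec (r i) = n" if "i \<in> {1..n}" for i using r[OF that] by (simp add: balanced_vecs_def)
  have row: "Matrix.row ?R a = r (a + 1)" if a: "a < n" for a
  proof (rule eq_vecI)
    have ra: "r (a + 1) \<in> balanced_vecs n" using r a by simp
    show "dim_vec (Matrix.row ?R a) = dim_vec (r (a + 1))" using dim[of "a + 1"] a M by simp
    fix b assume "b < dim_vec (r (a + 1))"
    hence "b < n" using dim[of "a + 1"] a by simp
    thus "vec_index (Matrix.row ?R a) b = vec_index (r (a + 1)) b"
      using a ra dim[of "a + 1"] by (auto simp: M_def vec_support_def balanced_vecs_def)
  qed
  have "r ` {1..m} = Matrix.row ?R ` {..<m}"
  proof -
    have "{1..m} = Suc ` {..<m}" by (simp add: image_Suc_lessThan)
    thus ?thesis using m row by (simp add: image_image)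
  qed
  hence "Determinant.det ?R = 0"
    using span row[OF m] by (intro in_span_imp_det_0[OF _ m]) (auto simp: M_def)
  hence "Determinant.det (transpose_mat M) = 0" using det_transpose[OF M] by simp
  moreover have "transpose_mat M \<in> carrier_mat n n" using M by simp
  ultimately obtain w where w: "w \<in> carrier_vec n" "w \<noteq> 0\<^sub>v n" "transpose_mat M *\<^sub>v w = 0\<^sub>v n"
    using det_0_iff_vec_prod_zero by blast
  have "\<exists>a<n. vec_index w a \<noteq> 0"
  proof (rule ccontr)
    assume "\<not> ?thesis"
    hence "w = 0\<^sub>v n" using w(1) by (intro eq_vecI) auto
    thus False using w(2) by simp
  qed
  then obtain g u where gu: "g \<noteq> 0" "\<forall>a<n. vec_index w a = g * u a" "\<exists>a<n. \<not> int p dvd u a"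
    using primitive_multiple[OF p, of n "vec_index w"] by blast
  have u0: "(\<Sum>a<n. u a * M $$ (a, k)) = 0" if k: "k < n" for k
  proof -
    have "0 = vec_index (transpose_mat M *\<^sub>v w) k" using w k by simp
    also have "\<dots> = (\<Sum>a<n. M $$ (a, k) * vec_index w a)"
      using M w(1) k by (simp add: scalar_prod_def atLeast0LessThan)
    also have "\<dots> = g * (\<Sum>a<n. u a * M $$ (a, k))"
      using gu(2) by (simp add: sum_distrib_left mult_ac)
    finally show ?thesis using gu(1) by simp
  qed
  obtain a where a: "a < n" "\<not> int p dvd u a" using gu(3) by blast
  show ?thesis
  proof (intro bexI[of _ "a + 1"] allI impI)
    fix v :: "nat \<Rightarrow> nat" assume v: "\<forall>j\<in>{1..n} - {a + 1}. p dvd (\<Sum>k\<in>vec_support (r j). v k)"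
    define s where "s b = int (\<Sum>k\<in>vec_support (r (b + 1)). v k)" for b
    have s: "s b = (\<Sum>k<n. M $$ (b, k) * int (v k))" if b: "b < n" for b
    proof -
      have "vec_support (r (b + 1)) \<subseteq> {..<n}" using dim[of "b + 1"] b by (auto simp: vec_support_def)
      hence "{..<n} \<inter> {k. k \<in> vec_support (r (b + 1))} = vec_support (r (b + 1))" by auto
      thus ?thesis using b by (simp add: s_def M_def if_distrib[of "\<lambda>x. x * _"] sum.If_cases)
    qed
    have "(\<Sum>b<n. u b * s b) = (\<Sum>k<n. (\<Sum>b<n. u b * M $$ (b, k)) * int (v k))"
      by (simp add: s sum_distrib_left sum_distrib_right mult.assoc) (rule sum.swap)
    hence "(\<Sum>b<n. u b * s b) = 0" using u0 by simp
    hence "u a * s a = - (\<Sum>b\<in>{..<n} - {a}. u b * s b)"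
      using a sum.remove[of "{..<n}" a "\<lambda>b. u b * s b"] by simp
    moreover have "int p dvd s b" if "b \<in> {..<n} - {a}" for b
      using v that unfolding s_def by (subst int_dvd_int_iff) auto
    hence "int p dvd (\<Sum>b\<in>{..<n} - {a}. u b * s b)" by (intro dvd_sum dvd_mult)
    ultimately have "int p dvd u a * s a" by simp
    hence "int p dvd s a" using a(2) p by (simp add: prime_dvd_mult_iff)
    thus "p dvd (\<Sum>k\<in>vec_support (r (a + 1)). v k)" unfolding s_def by (subst (asm) int_dvd_int_iff)
  qed (use a in auto)
qed

text \<open>Pigeonhole: fewer than n conditions take fewer than \<open>p ^ n\<close> values, so two
  vectors collide, and their difference modulo \<open>p\<close> is the required normal
  vector.\<close>

lemma exists_modular_normal:
  fixes p n :: nat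
  assumes p: "p > 1" and J: "finite J" "card J < n" and A: "\<And>j. j \<in> J \<Longrightarrow> A j \<subseteq> {..<n}"
  shows "\<exists>v\<in>{..<n} \<rightarrow>\<^sub>E {..<p}. (\<exists>k<n. v k \<noteq> 0) \<and> (\<forall>j\<in>J. p dvd (\<Sum>k\<in>A j. v k))"
proof -
  let ?V = "{..<n} \<rightarrow>\<^sub>E {..<p}" and ?W = "J \<rightarrow>\<^sub>E {..<p}"
  define F where "F = (\<lambda>v. \<lambda>j\<in>J. (\<Sum>k\<in>A j. v k) mod p)"
  have "card (F ` ?V) \<le> card ?W"
  proof (rule card_mono)
    show "finite ?W" using J by (intro finite_PiE) auto
    show "F ` ?V \<subseteq> ?W"
      unfolding F_def by (rule image_subsetI) (use p in \<open>simp add: restrict_PiE_iff\<close>)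
  qed
  also have "\<dots> = p ^ card J" using J by (simp add: card_PiE)
  also have "\<dots> < p ^ n" using p J by simp
  also have "\<dots> = card ?V" by (simp add: card_PiE)
  finally have "\<not> inj_on F ?V" using pigeonhole by blast
  then obtain v w where vw: "v \<in> ?V" "w \<in> ?V" "F v = F w" "v \<noteq> w" by (auto simp: inj_on_def)
  define d where "d = (\<lambda>k\<in>{..<n}. (v k + (p - w k)) mod p)"
  have lt: "v k < p" "w k < p" if "k < n" for k using vw that by auto
  have d: "[int (d k) = int (v k) - int (w k)] (mod int p)" if k: "k < n" for k
  proof -
    have "int (v k + (p - w k)) = (int (v k) - int (w k)) + int p" using lt[OF k] by simp
    thus ?thesis using k by (simp only: d_def restrict_apply lessThan_iff if_True cong_def zmod_int
      mod_mod_trivial mod_add_self2)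
  qed
  have "d \<in> ?V" unfolding d_def using p by (simp add: restrict_PiE_iff)
  moreover have "\<exists>k<n. d k \<noteq> 0"
  proof -
    obtain k where k: "v k \<noteq> w k" using vw(4) by blast
    have "k < n" using k vw(1,2) by (metis PiE_arb lessThan_iff)
    have "d k \<noteq> 0"
    proof
      assume "d k = 0"
      hence "[int (v k) = int (w k)] (mod int p)"
        using d[OF \<open>k < n\<close>] by (simp add: cong_iff_dvd_diff dvd_diff_commute)
      hence "[v k = w k] (mod p)" by (simp add: cong_int_iff)
      thus False using k lt[OF \<open>k < n\<close>] cong_less_modulus_unique_nat by blast
    qed
    thus ?thesis using \<open>k < n\<close> by blast
  qed
  moreover have "p dvd (\<Sum>k\<in>A j. d k)" if j: "j \<in> J" for j
  proof -
    have "[(\<Sum>k\<in>A j. int (d k)) = (\<Sum>k\<in>A j. int (v k) - int (w k))] (mod int p)"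
      using A[OF j] d by (intro cong_sum) auto
    also have "(\<Sum>k\<in>A j. int (v k) - int (w k)) = int (\<Sum>k\<in>A j. v k) - int (\<Sum>k\<in>A j. w k)"
      by (simp add: sum_subtractf)
    also have "[\<dots> = 0] (mod int p)"
    proof -
      have "(\<Sum>k\<in>A j. v k) mod p = (\<Sum>k\<in>A j. w k) mod p"
        using fun_cong[OF vw(3), of j] j by (simp add: F_def)
      hence "[int (\<Sum>k\<in>A j. v k) = int (\<Sum>k\<in>A j. w k)] (mod int p)"
        unfolding cong_int_iff by (simp add: cong_def)
      thus ?thesis by (simp add: cong_iff_dvd_diff cong_0_iff)
    qed
    finally have "[int (\<Sum>k\<in>A j. d k) = int 0] (mod int p)" by simp
    thus ?thesis unfolding cong_int_iff by (simp add: cong_0_iff)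
  qed
  ultimately show ?thesis by blast
qed

subsection \<open>The random matrix\<close>

lemma vec_support_in_layer:
  assumes "x \<in> balanced_vecs n" "even n"
  shows "vec_support x \<in> layer n (n div 2)"
proof -
  have dim: "dim_vec x = n" using assms by (simp add: balanced_vecs_def)
  have "vec_support x = {..<n} - {i. i < n \<and> vec_index x i = 0}"
    using assms dim by (auto simp: balanced_vecs_def vec_support_def)
  hence "card (vec_support x) = n - n div 2"
    using assms by (simp add: card_Diff_subset balanced_vecs_def subset_iff)
  thus ?thesis using assms dim by (auto simp: layer_def vec_support_def elim!: evenE)
qed

lemma bij_betw_vec_support:
  assumes "even n"
  shows "bij_betw vec_support (balanced_vecs n) (layer n (n div 2))"
proof (rule bij_betw_imageI)
  show "inj_on vec_support (balanced_vecs n)"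
  proof (rule inj_onI)
    fix x y assume xy: "x \<in> balanced_vecs n" "y \<in> balanced_vecs n" "vec_support x = vec_support y"
    show "x = y"
    proof (rule eq_vecI)
      fix i assume "i < dim_vec y"
      hence i: "i < n" using xy by (auto simp: balanced_vecs_def)
      hence "vec_index x i \<in> {0, 1}" "vec_index y i \<in> {0, 1}" using xy by (auto simp: balanced_vecs_def)
      moreover have "vec_index x i = 1 \<longleftrightarrow> vec_index y i = 1"
        using xy i unfolding vec_support_def balanced_vecs_def by (auto simp: set_eq_iff)
      ultimately show "vec_index x i = vec_index y i" by auto
    qed (use xy in \<open>auto simp: balanced_vecs_def\<close>)
  qed
  show "vec_support ` balanced_vecs n = layer n (n div 2)"
  proof (rule antisym)
    show "layer n (n div 2) \<subseteq> vec_support ` balanced_vecs n"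
    proof
      fix A assume A: "A \<in> layer n (n div 2)"
      define x where "x = Matrix.vec n (\<lambda>i. if i \<in> A then 1 else (0::real))"
      have "{i. i < n \<and> vec_index x i = 0} = {..<n} - A" by (auto simp: x_def)
      moreover have "card ({..<n} - A) = n div 2"
        using A assms by (auto simp: layer_def card_Diff_subset finite_subset elim!: evenE)
      ultimately have "x \<in> balanced_vecs n" by (auto simp: balanced_vecs_def x_def)
      moreover have "vec_support x = A" using A by (auto simp: vec_support_def x_def layer_def split: if_splits)
      ultimately show "A \<in> vec_support ` balanced_vecs n" by blast
    qed
  qed (use vec_support_in_layer[OF _ assms] in auto)
qed

lemma prob_zero_sets:
  assumes "even n"
  shows "measure_pmf.prob (pmf_of_set (balanced_vecs n)) {x. vec_support x \<in> zero_sets n p v} =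
    zero_prob n p v"
proof -
  let ?B = "balanced_vecs n" and ?T = "{x. vec_support x \<in> zero_sets n p v}"
  note bij = bij_betw_vec_support[OF assms]
  have "vec_support ` (?B \<inter> ?T) = zero_sets n p v"
  proof -
    have "vec_support ` ?B = layer n (n div 2)" using bij by (rule bij_betw_imp_surj_on)
    moreover have "zero_sets n p v \<subseteq> layer n (n div 2)" by (auto simp: zero_sets_def)
    moreover have "vec_support ` (?B \<inter> ?T) = vec_support ` ?B \<inter> zero_sets n p v" by auto
    ultimately show ?thesis by (simp only: Int_absorb1)
  qed
  moreover have "inj_on vec_support (?B \<inter> ?T)"
    using bij by (auto simp: bij_betw_def intro: inj_on_subset)
  ultimately have "card (?B \<inter> ?T) = card (zero_sets n p v)" by (metis card_image)
  moreover have "card ?B = card (layer n (n div 2))" using bij by (rule bij_betw_same_card)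
  ultimately show ?thesis
    by (simp add: measure_pmf_of_set balanced_vecs_nonempty finite_balanced_vecs zero_prob_def)
qed

text \<open>Conditioning on the second component, by Fubini.\<close>

lemma prob_pair_pmf_le:
  assumes "\<And>y. measure_pmf.prob M {x. (x, y) \<in> E} \<le> e" "e \<ge> 0"
  shows "measure_pmf.prob (pair_pmf M N) E \<le> e"
proof -
  have "emeasure (measure_pmf (pair_pmf M N)) E = (\<integral>\<^sup>+ z. indicator E z \<partial>pair_pmf M N)" by simp
  also have "\<dots> = (\<integral>\<^sup>+ z. indicator E (case z of (y, x) \<Rightarrow> (x, y)) \<partial>pair_pmf N M)"
    by (subst pair_commute_pmf) (simp add: case_prod_unfold)
  also have "\<dots> = (\<integral>\<^sup>+ y. \<integral>\<^sup>+ x. indicator {x. (x, y) \<in> E} x \<partial>M \<partial>N)"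
    by (simp add: nn_integral_pair_pmf' indicator_def)
  also have "\<dots> = (\<integral>\<^sup>+ y. emeasure (measure_pmf M) {x. (x, y) \<in> E} \<partial>N)" by simp
  also have "\<dots> \<le> (\<integral>\<^sup>+ y. ennreal e \<partial>N)"
    using assms by (intro nn_integral_mono) (simp add: measure_pmf.emeasure_eq_measure ennreal_leI)
  also have "\<dots> = ennreal e" by simp
  finally show ?thesis using assms(2) by (simp add: measure_pmf.emeasure_eq_measure)
qed

lemma prob_union_le:
  assumes "finite I"
  shows "measure_pmf.prob M (\<Union>i\<in>I. A i) \<le> (\<Sum>i\<in>I. measure_pmf.prob M (A i))"
  using assms by (intro measure_pmf.finite_measure_subadditive_finite) auto

lemma prob_structured_normal_le:
  assumes i: "i \<in> {1..n}" and n: "even n"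
  shows "measure_pmf.prob (Q_rows n)
      {r. \<exists>v\<in>structured n p q. \<forall>j\<in>{1..n} - {i}. vec_support (r j) \<in> zero_sets n p v}
    \<le> (\<Sum>v\<in>structured n p q. zero_prob n p v ^ (n - 1))"
proof -
  let ?D = "\<lambda>v. {r. \<forall>j\<in>{1..n} - {i}. vec_support (r j) \<in> zero_sets n p v}"
  have "measure_pmf.prob (Q_rows n) (?D v) = zero_prob n p v ^ (n - 1)" for v
  proof -
    \<comment> \<open>For \<open>j = i\<close> this is the full space, so the event is a product
      over all rows with one factor equal to 1.\<close>
    let ?Z = "\<lambda>j. {x. j \<noteq> i \<longrightarrow> vec_support x \<in> zero_sets n p v}"
    have "?D v = Pi {1..n} ?Z" by (auto simp: Pi_iff)
    hence "measure_pmf.prob (Q_rows n) (?D v) =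
        (\<Prod>j\<in>{1..n}. measure_pmf.prob (pmf_of_set (balanced_vecs n)) (?Z j))"
      by (simp only: Q_rows_def measure_Pi_pmf_Pi[OF finite_atLeastAtMost])
    also have "\<dots> = (\<Prod>j\<in>{1..n} - {i}. zero_prob n p v)"
      using i by (subst prod.remove[of _ i]) (auto simp: prob_zero_sets[OF n] intro!: prod.cong)
    also have "\<dots> = zero_prob n p v ^ (n - 1)" using i by simp
    finally show ?thesis .
  qed
  moreover have "{r. \<exists>v\<in>structured n p q. \<forall>j\<in>{1..n} - {i}. vec_support (r j) \<in> zero_sets n p v} =
      (\<Union>v\<in>structured n p q. ?D v)" by auto
  ultimately show ?thesis using prob_union_le[OF finite_structured, of "Q_rows n" ?D] by simp
qed

text \<open>Hypothesis \<open>sel\<close> expresses that the choice ignores row \<open>i\<close>.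
  Once the other rows are fixed the chosen vector is fixed too, and only row \<open>i\<close>
  remains random.\<close>

lemma prob_unstructured_normal_le:
  assumes i: "i \<in> {1..n}" and e: "e \<ge> 0" and n: "even n"
    and V: "\<And>v. v \<in> V \<Longrightarrow> zero_prob n p v \<le> e"
    and sel: "\<And>r x. sel (r(i := x)) = sel r"
  shows "measure_pmf.prob (Q_rows n) {r. sel r \<in> V \<and> vec_support (r i) \<in> zero_sets n p (sel r)} \<le> e"
proof -
  let ?U = "pmf_of_set (balanced_vecs n)"
  let ?H = "{r. sel r \<in> V \<and> vec_support (r i) \<in> zero_sets n p (sel r)}"
  have "Q_rows n = Pi_pmf (insert i ({1..n} - {i})) (0\<^sub>v n) (\<lambda>_. ?U)"
    using i by (simp add: Q_rows_def insert_absorb)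
  also have "\<dots> = map_pmf (\<lambda>(y, f). f(i := y)) (pair_pmf ?U (Pi_pmf ({1..n} - {i}) (0\<^sub>v n) (\<lambda>_. ?U)))"
    by (rule Pi_pmf_insert) auto
  finally have Q: "Q_rows n = \<dots>" .
  show ?thesis unfolding Q measure_map_pmf
  proof (rule prob_pair_pmf_le[OF _ e])
    fix f
    show "measure_pmf.prob ?U {x. (x, f) \<in> (\<lambda>(y, f). f(i := y)) -` ?H} \<le> e"
    proof (cases "sel f \<in> V")
      case True
      have "{x. (x, f) \<in> (\<lambda>(y, f). f(i := y)) -` ?H} = {x. vec_support x \<in> zero_sets n p (sel f)}"
        using True sel by auto
      thus ?thesis using V[OF True] by (simp add: prob_zero_sets[OF n])
    next
      case False
      hence "{x. (x, f) \<in> (\<lambda>(y, f). f(i := y)) -` ?H} = {}" using sel by auto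
      thus ?thesis using e by (metis measure_empty)
    qed
  qed
qed

text \<open>
  The normal vector is selected from the rows other than \<open>i\<close> only, hence independently of row \<open>i\<close>.
\<close>

theorem prob_dependent_row_le:
  assumes n: "even n" and m: "1 \<le> m" "m \<le> n - 1" and p: "prime p" "n < p"
    and q: "real n * real p * (1 - 1 / 131072) ^ q \<le> 1"
  shows "measure_pmf.prob (Q_rows n) {r. r (m + 1) \<in> span_vec n (r ` {1..m})} \<le>
    real n * ((\<Sum>v\<in>structured n p q. zero_prob n p v ^ (n - 1)) + 8 / real p)"
proof -
  have p0: "p > 0" and n0: "n > 0" "m < n" using p m by auto
  define normal where "normal i r v \<longleftrightarrow> v \<in> {..<n} \<rightarrow>\<^sub>E {..<p} \<and> (\<exists>k<n. v k \<noteq> 0) \<and>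
    (\<forall>j\<in>{1..n} - {i}. vec_support (r j) \<in> zero_sets n p v)" for i r v
  define sel where "sel i r = (SOME v. normal i r v)" for i r
  define V where "V = {v \<in> {..<n} \<rightarrow>\<^sub>E {..<p}. (\<exists>k<n. v k \<noteq> 0) \<and> v \<notin> structured n p q}"
  let ?G = "\<lambda>i. {r. \<exists>v\<in>structured n p q. \<forall>j\<in>{1..n} - {i}. vec_support (r j) \<in> zero_sets n p v}"
  let ?H = "\<lambda>i. {r. sel i r \<in> V \<and> vec_support (r i) \<in> zero_sets n p (sel i r)}"
  let ?E = "{r. r (m + 1) \<in> span_vec n (r ` {1..m})}"
  \<comment> \<open>Rows are known to be balanced only on the support of their law, hence the
    intersection.\<close>
  have "?E \<inter> set_pmf (Q_rows n) \<subseteq> (\<Union>i\<in>{1..n}. ?G i \<union> ?H i)"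
  proof
    fix r assume r: "r \<in> ?E \<inter> set_pmf (Q_rows n)"
    hence B: "r j \<in> balanced_vecs n" if "j \<in> {1..n}" for j
      using that by (auto simp: Q_rows_def set_Pi_pmf PiE_dflt_def balanced_vecs_nonempty finite_balanced_vecs)
    have L: "vec_support (r j) \<in> layer n (n div 2)" if "j \<in> {1..n}" for j
      using vec_support_in_layer[OF B[OF that] n] .
    hence Z: "vec_support (r j) \<in> zero_sets n p v \<longleftrightarrow> p dvd (\<Sum>k\<in>vec_support (r j). v k)"
      if "j \<in> {1..n}" for j v using that by (simp add: zero_sets_def)
    have span: "r (m + 1) \<in> span_vec n (r ` {1..m})" using r by simp
    from modular_row_dependency[OF B n0(2) span p(1)] obtain i where i: "i \<in> {1..n}"
      and dep: "\<And>v. (\<forall>j\<in>{1..n} - {i}. p dvd (\<Sum>k\<in>vec_support (r j). v k)) \<Longrightarrow>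
        p dvd (\<Sum>k\<in>vec_support (r i). v k)"
      by blast
    have "\<exists>v\<in>{..<n} \<rightarrow>\<^sub>E {..<p}. (\<exists>k<n. v k \<noteq> 0) \<and> (\<forall>j\<in>{1..n} - {i}. p dvd (\<Sum>k\<in>vec_support (r j). v k))"
    proof (rule exists_modular_normal)
      show "vec_support (r j) \<subseteq> {..<n}" if "j \<in> {1..n} - {i}" for j
        using L[of j] that by (auto simp: layer_def)
    qed (use i p m in auto)
    hence "\<exists>v. normal i r v" using Z unfolding normal_def by auto
    hence "normal i r (sel i r)" unfolding sel_def by (rule someI_ex)
    moreover from this have "vec_support (r i) \<in> zero_sets n p (sel i r)"
      using dep[of "sel i r"] Z i by (auto simp: normal_def)
    ultimately have "r \<in> ?G i \<union> ?H i"
      by (cases "sel i r \<in> structured n p q") (auto simp: normal_def V_def)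
    thus "r \<in> (\<Union>i\<in>{1..n}. ?G i \<union> ?H i)" using i by blast
  qed
  hence "measure_pmf.prob (Q_rows n) ?E \<le> measure_pmf.prob (Q_rows n) (\<Union>i\<in>{1..n}. ?G i \<union> ?H i)"
    by (subst measure_Int_set_pmf[symmetric]) (intro measure_pmf.finite_measure_mono, auto)
  also have "\<dots> \<le> (\<Sum>i\<in>{1..n}. measure_pmf.prob (Q_rows n) (?G i \<union> ?H i))"
    by (rule prob_union_le) simp
  also have "\<dots> \<le> (\<Sum>i\<in>{1..n}. (\<Sum>v\<in>structured n p q. zero_prob n p v ^ (n - 1)) + 8 / real p)"
  proof (rule sum_mono)
    fix i assume i: "i \<in> {1..n}"
    have "measure_pmf.prob (Q_rows n) (?G i \<union> ?H i) \<le>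
        measure_pmf.prob (Q_rows n) (?G i) + measure_pmf.prob (Q_rows n) (?H i)"
      by (intro measure_Un_le) auto
    also have "measure_pmf.prob (Q_rows n) (?H i) \<le> 8 / real p"
    proof (rule prob_unstructured_normal_le[OF i _ n])
      fix v assume "v \<in> V"
      hence "\<not> 5 \<le> card (spectrum n p q v)" unfolding V_def structured_def by blast
      hence "card (spectrum n p q v) \<le> 4" by simp
      moreover have "real p * zero_prob n p v \<le> 2 * real (card (spectrum n p q v))"
        by (rule zero_prob_le_spectrum[OF n0(1) n p0 q])
      ultimately have "real p * zero_prob n p v \<le> 8" by linarith
      thus "zero_prob n p v \<le> 8 / real p" using p0 by (simp add: field_simps)
    next
      show "sel i (r(i := x)) = sel i r" for r x by (simp add: sel_def normal_def)
    qed simp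
    finally show "measure_pmf.prob (Q_rows n) (?G i \<union> ?H i) \<le>
        (\<Sum>v\<in>structured n p q. zero_prob n p v ^ (n - 1)) + 8 / real p"
      using prob_structured_normal_le[OF i n, of p q] by linarith
  qed
  finally show ?thesis by simp
qed

section \<open>Choice of the parameters\<close>

lemma one_minus_power_le_exp:
  fixes x :: real
  assumes "0 \<le> x" "x \<le> 1"
  shows "(1 - x) ^ k \<le> exp (- (x * real k))"
proof -
  have "(1 - x) ^ k \<le> exp (- x) ^ k"
    using assms exp_ge_add_one_self[of "- x"] by (intro power_mono) auto
  thus ?thesis by (simp add: mult_ac flip: exp_of_nat_mult)
qed

text \<open>\<open>l\<close> is about 8 ln p because (7/8)^l \<le> exp(-l/8); \<open>q\<close> is
  about 131072 ln(np), at most 262144 ln p since n < p. Thus \<open>l * q\<close> has order t^2, and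
  \<open>big\<close> says that the total cost, cubic in \<open>t\<close>, loses against (5/4)^(n-1).
  The \<open>C + 1\<close> there pays for the factor n in front of the sum.\<close>

lemma structured_sum_bound:
  fixes n p :: nat and C t :: real
  assumes n: "n \<ge> 2" "even n" and p: "prime p" "n < p" and t: "ln (real p) \<le> t"
    and lq: "4 * ((8 * t + 2) * (262144 * t + 1)) \<le> real n"
    and big: "(C + 1) * ln (real n) + t * (2 * (8 * t + 2) * (262144 * t + 2) + 2) \<le> (real n - 1) * ln (5 / 4)"
  shows "\<exists>q. real n * real p * (1 - 1 / 131072) ^ q \<le> 1 \<and>
    real n * (\<Sum>v\<in>structured n p q. zero_prob n p v ^ (n - 1)) \<le> real n powr (- C)"
proof -
  have p2: "p \<ge> 3" "n > 0" using p n by auto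
  have lp: "ln (real p) > 0" using p2 by simp
  define l where "l = nat \<lfloor>8 * ln (real p)\<rfloor> + 1"
  define q where "q = nat \<lceil>131072 * ln (real n * real p)\<rceil>"
  have lnp: "0 \<le> ln (real n * real p)" "ln (real n * real p) \<le> 2 * ln (real p)"
  proof -
    have "1 * 1 \<le> real n * real p" using p2 by (intro mult_mono) auto
    thus "0 \<le> ln (real n * real p)" by simp
    have "ln (real n * real p) = ln (real n) + ln (real p)" using p2 by (simp add: ln_mult)
    moreover have "ln (real n) \<le> ln (real p)" using p p2 by simp
    ultimately show "ln (real n * real p) \<le> 2 * ln (real p)" by simp
  qed
  have l1: "real l > 8 * ln (real p)" and l2: "real l \<le> 8 * t + 2" using lp t unfolding l_def by linarith+
  have q1: "real q \<ge> 131072 * ln (real n * real p)" and q2: "real q \<le> 262144 * t + 1"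
    using lnp t unfolding q_def by linarith+
  have l: "(7 / 8) ^ l * real p < 1"
  proof -
    have "(7 / 8) ^ l \<le> exp (- (1 / 8 * real l))" using one_minus_power_le_exp[of "1 / 8" l] by simp
    also have "\<dots> < exp (- ln (real p))" using l1 by simp
    finally show ?thesis using p2 by (simp add: exp_minus field_simps)
  qed
  have q: "real n * real p * (1 - 1 / 131072) ^ q \<le> 1"
  proof -
    have "(1 - 1 / 131072) ^ q \<le> exp (- (1 / 131072 * real q))" by (rule one_minus_power_le_exp) auto
    also have "\<dots> \<le> exp (- ln (real n * real p))" using q1 by simp
    also have "\<dots> = 1 / (real n * real p)" using p2 by (simp add: exp_minus field_simps)
    finally show ?thesis using p2 by (simp add: field_simps)
  qed
  have t0: "t > 0" using lp t by linarith
  have lq2: "real (l * q) \<le> (8 * t + 2) * (262144 * t + 1)"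
    unfolding of_nat_mult using l2 q2 t0 by (intro mult_mono) auto
  hence "real (4 * (l * q)) \<le> real n" using lq by simp
  hence lqn: "4 * (l * q) \<le> n" by (simp only: of_nat_le_iff)
  \<comment> \<open>All counts are absorbed crudely into powers of \<open>p\<close>, by p + 1 \<le>
    p^2 and n + 1 \<le> p.\<close>
  have "(p + 1) ^ l * ((n + 1) ^ (l * q) * p) * p ^ (l * q + 1) \<le> (p ^ 2) ^ l * (p ^ (l * q) * p) * p ^ (l * q + 1)"
  proof (intro mult_le_mono le_refl power_mono)
    have "p + 1 \<le> 3 * p" using p2 by simp
    also have "\<dots> \<le> p * p" using p2 by (intro mult_le_mono1)
    finally show "p + 1 \<le> p\<^sup>2" by (simp add: power2_eq_square)
  qed (use p in auto)
  also have "(p ^ 2) ^ l * (p ^ k * p) * p ^ (k + 1) = p ^ (2 * l + 2 * k + 2)" for k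
    by (simp add: power_add power_mult power2_eq_square power_mult_distrib)
  finally have "real ((p + 1) ^ l * ((n + 1) ^ (l * q) * p) * p ^ (l * q + 1)) \<le> real p ^ (2 * l + 2 * (l * q) + 2)"
    by (metis of_nat_le_iff of_nat_power)
  also have "\<dots> = exp (ln (real p) * real (2 * l + 2 * (l * q) + 2))"
    unfolding exp_of_nat2_mult using p2 by simp
  also have "\<dots> \<le> exp (t * (2 * (8 * t + 2) * (262144 * t + 2) + 2))"
  proof -
    have "real (2 * l + 2 * (l * q) + 2) \<le> 2 * (8 * t + 2) + 2 * ((8 * t + 2) * (262144 * t + 1)) + 2"
      using l2 lq2 by simp
    also have "\<dots> = 2 * (8 * t + 2) * (262144 * t + 2) + 2" by (simp add: algebra_simps)
    finally show ?thesis using t t0 lp by (subst exp_le_cancel_iff, intro mult_mono) auto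
  qed
  finally have A: "real ((p + 1) ^ l * ((n + 1) ^ (l * q) * p) * p ^ (l * q + 1)) \<le> \<dots>" .
  have B: "(4 / 5 :: real) ^ (n - 1) = exp (- ((real n - 1) * ln (5 / 4)))"
  proof -
    have "(4 / 5 :: real) = exp (- ln (5 / 4))" by (simp add: exp_minus)
    hence "(4 / 5 :: real) ^ (n - 1) = exp (real (n - 1) * - ln (5 / 4))"
      by (metis exp_of_nat_mult)
    thus ?thesis using n by (simp add: of_nat_diff)
  qed
  have "(\<Sum>v\<in>structured n p q. zero_prob n p v ^ (n - 1)) \<le>
      real ((p + 1) ^ l * ((n + 1) ^ (l * q) * p) * p ^ (l * q + 1)) * (4 / 5) ^ (n - 1)"
    by (rule sum_structured_le[OF p2(2) n(2) p q l lqn])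
  also have "\<dots> \<le> exp (t * (2 * (8 * t + 2) * (262144 * t + 2) + 2)) * (4 / 5) ^ (n - 1)"
    using A by (intro mult_right_mono) auto
  also have "\<dots> = exp (t * (2 * (8 * t + 2) * (262144 * t + 2) + 2) - (real n - 1) * ln (5 / 4))"
    unfolding B by (simp flip: exp_add)
  also have "\<dots> \<le> exp (- ((C + 1) * ln (real n)))"
    using big by simp
  finally have "real n * (\<Sum>v\<in>structured n p q. zero_prob n p v ^ (n - 1)) \<le>
      real n * exp (- ((C + 1) * ln (real n)))"
    by (intro mult_left_mono) auto
  also have "\<dots> = real n powr (1 + - (C + 1))"
    unfolding powr_add using p2 by (simp add: powr_def algebra_simps)
  also have "1 + - (C + 1) = - C" by simp
  finally show ?thesis using q by blast
qed

text \<open>The constant 9 is 1 from the vectors with a large spectrum plus 8 from the rest.\<close>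

lemma eventually_prob_dependent_row_le:
  fixes C :: real
  assumes C: "C > 0"
  shows "eventually (\<lambda>n. \<forall>m. even n \<longrightarrow> 1 \<le> m \<longrightarrow> m \<le> n - 1 \<longrightarrow>
    measure_pmf.prob (Q_rows n) {r. r (m + 1) \<in> span_vec n (r ` {1..m})} \<le> 9 * real n powr (- C)) sequentially"
proof -
  \<comment> \<open>The prime lies between n^a and 2 n^(2a): a \<ge> C + 1 makes 8n / p at most 8
    n^(-C), and \<open>b\<close> is chosen so that ln p \<le> ln 2 + 2a ln n \<le> b ln n.\<close>
  define a where "a = nat \<lceil>C\<rceil> + 2"
  define b where "b = 2 * real a + 1"
  have a: "real a \<ge> C + 1" "a > 0" using C unfolding a_def by linarith+
  have b: "b > 0" by (simp add: b_def)
  have "filterlim (\<lambda>n::nat. n ^ a) at_top sequentially"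
  proof (rule filterlim_at_top_mono[OF filterlim_ident])
    show "eventually (\<lambda>n::nat. n \<le> n ^ a) sequentially"
      using eventually_gt_at_top[of 0] by eventually_elim (use a in \<open>auto intro: self_le_power\<close>)
  qed
  from eventually_compose_filterlim[OF eventually_prime_between this]
  have "eventually (\<lambda>n. \<exists>p. prime p \<and> n ^ a < p \<and> p \<le> 2 * (n ^ a)\<^sup>2) sequentially" .
  moreover have "eventually (\<lambda>n::nat. 4 * ((8 * (b * ln (real n)) + 2) * (262144 * (b * ln (real n)) + 1)) \<le> real n) sequentially"
    using b by real_asymp
  moreover have "eventually (\<lambda>n::nat. (C + 1) * ln (real n) + (b * ln (real n)) *
      (2 * (8 * (b * ln (real n)) + 2) * (262144 * (b * ln (real n)) + 2) + 2) \<le> (real n - 1) * ln (5 / 4)) sequentially"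
    using b by real_asymp
  moreover have "eventually (\<lambda>n::nat. n \<ge> 2) sequentially" by (rule eventually_ge_at_top)
  ultimately show ?thesis
  proof eventually_elim
    case (elim n)
    then obtain p where p: "prime p" "n ^ a < p" "p \<le> 2 * (n ^ a)\<^sup>2" by blast
    have n2: "n \<ge> 2" by (rule elim)
    have "n \<le> n ^ a" using a n2 by (intro self_le_power) auto
    hence np: "n < p" using p by linarith
    have "real p \<le> real (2 * (n ^ a)\<^sup>2)" using p(3) by (rule of_nat_mono)
    hence "ln (real p) \<le> ln (2 * (real n ^ a)\<^sup>2)" using np n2 by (subst ln_le_cancel_iff) auto
    also have "\<dots> = ln 2 + 2 * real a * ln (real n)"
      using n2 by (simp add: ln_mult ln_realpow)
    also have "\<dots> \<le> b * ln (real n)" using n2 by (simp add: b_def algebra_simps)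
    finally have t: "ln (real p) \<le> b * ln (real n)" .
    show ?case
    proof (intro allI impI)
      fix m assume n: "even n" and m: "1 \<le> m" "m \<le> n - 1"
      obtain q where q: "real n * real p * (1 - 1 / 131072) ^ q \<le> 1"
        "real n * (\<Sum>v\<in>structured n p q. zero_prob n p v ^ (n - 1)) \<le> real n powr (- C)"
        using structured_sum_bound[OF n2 n p(1) np t elim(2,3)] by metis
      have "real n * (8 / real p) \<le> 8 * real n powr (- C)"
      proof -
        have "real n powr (1 + C) \<le> real n powr real a" using a n2 by (intro powr_mono) auto
        also have "\<dots> = real (n ^ a)" using n2 by (simp add: powr_realpow)
        also have "\<dots> \<le> real p" using p(2) by linarith
        finally have "real n powr (1 + C) \<le> real p" .
        moreover have "real n = real n powr (1 + C) * real n powr (- C)"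
          using n2 by (simp flip: powr_add)
        ultimately have "real n \<le> real p * real n powr (- C)"
          by (metis mult_right_mono powr_ge_zero)
        thus ?thesis using np by (simp add: divide_le_eq mult_ac)
      qed
      moreover have "measure_pmf.prob (Q_rows n) {r. r (m + 1) \<in> span_vec n (r ` {1..m})} \<le>
          real n * ((\<Sum>v\<in>structured n p q. zero_prob n p v ^ (n - 1)) + 8 / real p)"
        by (rule prob_dependent_row_le[OF n m p(1) np q(1)])
      ultimately show "measure_pmf.prob (Q_rows n) {r. r (m + 1) \<in> span_vec n (r ` {1..m})} \<le> 9 * real n powr (- C)"
        using q(2) by (simp add: distrib_left)
    qed
  qed
qed

theorem theorem4p1:
  "\<forall>C::real. C > 0 \<longrightarrow>
     (\<exists>K::real. \<forall>n m :: nat. even n \<and> 1 \<le> m \<and> m \<le> n - 1 \<longrightarrow>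
        measure_pmf.prob (Q_rows n)
          {r. dim_subspace n (span_vec n (r ` {1..m})) = m \<and>
              r (m + 1) \<in> span_vec n (r ` {1..m})}
        \<le> K * real n powr (- C))"
proof (intro allI impI)
  fix C :: real assume C: "C > 0"
  obtain n0 where n0: "\<And>n m. n \<ge> n0 \<Longrightarrow> even n \<Longrightarrow> 1 \<le> m \<Longrightarrow> m \<le> n - 1 \<Longrightarrow>
      measure_pmf.prob (Q_rows n) {r. r (m + 1) \<in> span_vec n (r ` {1..m})} \<le> 9 * real n powr (- C)"
    using eventually_prob_dependent_row_le[OF C] unfolding eventually_sequentially by blast
  \<comment> \<open>The summand \<open>n0 powr C\<close> serves the n below \<open>n0\<close>, where
    the trivial bound 1 on the probability suffices.\<close>
  let ?K = "9 + real n0 powr C"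
  show "\<exists>K::real. \<forall>n m :: nat. even n \<and> 1 \<le> m \<and> m \<le> n - 1 \<longrightarrow>
      measure_pmf.prob (Q_rows n)
        {r. dim_subspace n (span_vec n (r ` {1..m})) = m \<and> r (m + 1) \<in> span_vec n (r ` {1..m})}
      \<le> K * real n powr (- C)"
  proof (intro exI[of _ ?K] allI impI, elim conjE)
    fix n m :: nat assume nm: "even n" "1 \<le> m" "m \<le> n - 1"
    let ?P = "measure_pmf.prob (Q_rows n)"
    let ?A = "{r. dim_subspace n (span_vec n (r ` {1..m})) = m \<and> r (m + 1) \<in> span_vec n (r ` {1..m})}"
    show "?P ?A \<le> ?K * real n powr (- C)"
    proof (cases "n \<ge> n0")
      case True
      have "?P ?A \<le> ?P {r. r (m + 1) \<in> span_vec n (r ` {1..m})}"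
        by (intro measure_pmf.finite_measure_mono) auto
      also have "\<dots> \<le> 9 * real n powr (- C)" by (rule n0[OF True nm])
      also have "\<dots> \<le> ?K * real n powr (- C)" by (intro mult_right_mono) auto
      finally show ?thesis .
    next
      case False
      have "?P ?A \<le> 1" by simp
      also have "1 = real n powr C * real n powr (- C)" using nm by (simp flip: powr_add)
      also have "\<dots> \<le> ?K * real n powr (- C)"
        using False C by (intro mult_right_mono add_increasing powr_mono2) auto
      finally show ?thesis .
    qed
  qed
qed

end
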